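(* Let $I$ be a non-empty index set and let $\{T_i\}_{i\in I}$ be a family of (not necessarily commuting) contractive $C_0$-semigroups on a Hilbert space $\mathcal{H}$. Then there exist a Hilbert space $\mathcal{H}'$, a family $\{U_i\}_{i\in I}$ of strongly continuous unitary representations of $(\mathbb{R},+)$ on $\mathcal{H}'$, and an isometry $r:\mathcal{H}\to\mathcal{H}'$ such that $$\prod_{k=1}^{N}T_{i_k}(t_k)=r^{*}\Big(\prod_{k=1}^{N}U_{i_k}(t_k)\Big)r$$ for all $N\in\mathbb{N}$, all sequences $(i_k)_{k=1}^{N}\subseteq I$, and all $(t_k)_{k=1}^{N}\subseteq\mathbb{R}_{\geq 0}$.
   Context: Hilbert spaces are complex. $\mathbb{R}_{\ge 0}=\{t\in\mathbb{R}: t\ge 0\}$ and $\mathbb{N}=\{1,2,\ldots\}$. A contractive $C_0$-semigroup on $\mathcal{H}$ is a family $\{T(t)\}_{t\ge 0}$ of linear contractions with $T(0)=\mathbf{1}$, $T(s+t)=T(s)T(t)$, continuous in the strong operator topology. Products are ordered from left to right: $\prod_{k=1}^N A_k=A_1A_2\cdots A_N$. *)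

theory Defs
  imports "HOL-Analysis.Analysis" "HOL-Algebra.Module"
begin

section \<open>Complex Hilbert spaces with explicit carriers\<close>

text \<open>
  The Hilbert space of a dilation has to be existentially quantified, which rules out a type-class
  formulation. Hilbert spaces are therefore records with a carrier, built on the modules of
  HOL-Algebra over the field of complex numbers. As HOL cannot quantify over types either, an
  existentially quantified space needs a fixed type for its vectors. For a family of semigroups
  indexed by \<open>'i\<close> on a space with vectors in \<open>'a\<close>, the type \<open>'i \<Rightarrow> real \<Rightarrow> 'a\<close> is large enough:
  if each Sz.-Nagy dilation is minimal and they are glued along the common subspace \<open>H\<close>,
  a vector \<open>v\<close> is determined by the family of all \<open>r\<^sup>* (U i s v)\<close>. The components \<open>mult\<close> and \<open>one\<close>,
  which the record type \<open>module\<close> inherits from \<open>ring\<close>, carry no meaning for a module.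
\<close>

definition complex_ring :: "complex ring"
  where "complex_ring = \<lparr>carrier = UNIV, mult = (*), one = 1, zero = 0, add = (+)\<rparr>"

lemma complex_ring_simps [simp]:
  "carrier complex_ring = UNIV"
  "mult complex_ring x y = x * y"
  "one complex_ring = 1"
  "zero complex_ring = 0"
  "add complex_ring x y = x + y"
  by (simp_all add: complex_ring_def)

lemma field_complex_ring: "Ring.field complex_ring"
proof (rule cring.cring_fieldI)
  have "x \<in> Units (add_monoid complex_ring)" for x
    by (auto simp: Units_def intro!: exI[of _ "- x"])
  then show "cring complex_ring"
    by unfold_locales (auto simp: algebra_simps)
  show "Units complex_ring = carrier complex_ring - {\<zero>\<^bsub>complex_ring\<^esub>}"
  proof
    show "carrier complex_ring - {\<zero>\<^bsub>complex_ring\<^esub>} \<subseteq> Units complex_ring"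
    proof
      fix x assume "x \<in> carrier complex_ring - {\<zero>\<^bsub>complex_ring\<^esub>}"
      then show "x \<in> Units complex_ring"
        by (auto simp: Units_def intro!: exI[of _ "inverse x"])
    qed
  qed (auto simp: Units_def)
qed

record 'a cinner_space = "(complex, 'a) module" +
  cinner :: "'a \<Rightarrow> 'a \<Rightarrow> complex"

text \<open>The inner product is linear in the first and conjugate-linear in the second argument.\<close>

locale complex_inner_space = Module.module complex_ring H
  for H :: "('a, 'm) cinner_space_scheme" (structure) +
  assumes cinner_add_left:
      "\<lbrakk>x \<in> carrier H; y \<in> carrier H; z \<in> carrier H\<rbrakk>
        \<Longrightarrow> cinner H (x \<oplus> y) z = cinner H x z + cinner H y z"
    and cinner_smult_left:
      "\<lbrakk>x \<in> carrier H; y \<in> carrier H\<rbrakk> \<Longrightarrow> cinner H (c \<odot> x) y = c * cinner H x y"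
    and cinner_commute:
      "\<lbrakk>x \<in> carrier H; y \<in> carrier H\<rbrakk> \<Longrightarrow> cinner H x y = cnj (cinner H y x)"
    and cinner_nonneg: "x \<in> carrier H \<Longrightarrow> 0 \<le> Re (cinner H x x)"
    and cinner_eq_zeroD: "\<lbrakk>x \<in> carrier H; cinner H x x = 0\<rbrakk> \<Longrightarrow> x = \<zero>"

definition cnorm :: "('a, 'm) cinner_space_scheme \<Rightarrow> 'a \<Rightarrow> real"
  where "cnorm H x = sqrt (Re (cinner H x x))"

text \<open>
  The locale \<open>Metric_space\<close> wants a distance that is nonnegative and symmetric on the whole type,
  hence the value 0 outside the carrier.
\<close>

definition cdist :: "('a, 'm) cinner_space_scheme \<Rightarrow> 'a \<Rightarrow> 'a \<Rightarrow> real"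
  where "cdist H x y =
    (if x \<in> carrier H \<and> y \<in> carrier H then cnorm H (x \<ominus>\<^bsub>H\<^esub> y) else 0)"

context complex_inner_space
begin

lemma diff_eq_zero_iff:
  assumes x: "x \<in> carrier H" and y: "y \<in> carrier H"
  shows "x \<ominus> y = \<zero> \<longleftrightarrow> x = y"
proof
  assume "x \<ominus> y = \<zero>"
  then have "(x \<oplus> \<ominus> y) \<oplus> y = y" using y by (simp add: M.minus_eq)
  then show "x = y" using x y by (simp add: M.a_assoc M.l_neg)
qed (use y in \<open>simp add: M.minus_eq M.r_neg\<close>)

lemma cinner_smult_right:
  assumes "x \<in> carrier H" "y \<in> carrier H"
  shows "cinner H x (c \<odot> y) = cnj c * cinner H x y"
proof -
  have "c \<odot> y \<in> carrier H"
    using assms smult_closed by simp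
  then show ?thesis
    using assms cinner_smult_left[of y x c] cinner_commute[of x "c \<odot> y"] cinner_commute[of x y]
    by simp
qed

lemma cinner_add_right:
  assumes "x \<in> carrier H" "y \<in> carrier H" "z \<in> carrier H"
  shows "cinner H x (y \<oplus> z) = cinner H x y + cinner H x z"
  using assms cinner_add_left[of y z x] cinner_commute[of x "y \<oplus> z"] cinner_commute[of x y]
    cinner_commute[of x z]
  by simp

lemma cinner_zero_left:
  assumes "x \<in> carrier H"
  shows "cinner H \<zero> x = 0"
  using cinner_add_left[of \<zero> \<zero> x] assms by simp

lemma cinner_zero_right:
  assumes "x \<in> carrier H"
  shows "cinner H x \<zero> = 0"
  using cinner_add_right[of x \<zero> \<zero>] assms by simp

lemma cinner_minus_left:
  assumes "x \<in> carrier H" "y \<in> carrier H"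
  shows "cinner H (\<ominus> x) y = - cinner H x y"
  using cinner_add_left[of x "\<ominus> x" y] assms
  by (simp add: M.r_neg cinner_zero_left add_eq_0_iff)

lemma cinner_minus_right:
  assumes "x \<in> carrier H" "y \<in> carrier H"
  shows "cinner H x (\<ominus> y) = - cinner H x y"
  using cinner_add_right[of x y "\<ominus> y"] assms
  by (simp add: M.r_neg cinner_zero_right add_eq_0_iff)

lemma cinner_diff_left:
  assumes "x \<in> carrier H" "y \<in> carrier H" "z \<in> carrier H"
  shows "cinner H (x \<ominus> y) z = cinner H x z - cinner H y z"
  using assms by (simp add: M.minus_eq cinner_add_left cinner_minus_left)

lemma cinner_diff_right:
  assumes "x \<in> carrier H" "y \<in> carrier H" "z \<in> carrier H"
  shows "cinner H x (y \<ominus> z) = cinner H x y - cinner H x z"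
  using assms by (simp add: M.minus_eq cinner_add_right cinner_minus_right)

lemma cinner_self_real:
  assumes "x \<in> carrier H"
  shows "cinner H x x = complex_of_real (Re (cinner H x x))"
  using cinner_commute[OF assms assms] by (simp add: complex_eq_iff)

lemma cnorm_nonneg: "x \<in> carrier H \<Longrightarrow> 0 \<le> cnorm H x"
  by (simp add: cnorm_def cinner_nonneg)

lemma cnorm_power2: "x \<in> carrier H \<Longrightarrow> (cnorm H x)\<^sup>2 = Re (cinner H x x)"
  by (simp add: cnorm_def cinner_nonneg)

lemma cnorm_eq_zero_iff:
  assumes "x \<in> carrier H"
  shows "cnorm H x = 0 \<longleftrightarrow> x = \<zero>"
proof
  assume "cnorm H x = 0"
  then have "cinner H x x = 0"
    using cinner_self_real[OF assms] by (simp add: cnorm_def)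
  then show "x = \<zero>"
    using cinner_eq_zeroD assms by blast
qed (simp add: cnorm_def cinner_zero_left)

lemma Cauchy_Schwarz:
  assumes x: "x \<in> carrier H" and y: "y \<in> carrier H"
  shows "cmod (cinner H x y) \<le> cnorm H x * cnorm H y"
proof (cases "y = \<zero>")
  case True
  then show ?thesis using x y by (simp add: cinner_zero_right cnorm_def cinner_zero_left)
next
  case False
  define b where "b = Re (cinner H y y)"
  define a where "a = cinner H x y"
  define c where "c = a / b"
  have "cnorm H y \<noteq> 0" using False y cnorm_eq_zero_iff by blast
  then have "b > 0" using cnorm_power2[OF y] by (metis b_def zero_less_power2)
  have cy: "c \<odot> y \<in> carrier H"
    using y smult_closed by simp
  have yx: "cinner H y x = cnj a" using cinner_commute[OF y x] by (simp add: a_def)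
  have yy: "cinner H y y = complex_of_real b" using cinner_self_real[OF y] by (simp add: b_def)
  have "0 \<le> Re (cinner H (x \<ominus> c \<odot> y) (x \<ominus> c \<odot> y))"
    using x cy by (intro cinner_nonneg M.minus_closed)
  also have "cinner H (x \<ominus> c \<odot> y) (x \<ominus> c \<odot> y) =
      cinner H x x - cnj c * a - (c * cnj a - c * cnj c * b)"
    using x y cy
    by (simp add: cinner_diff_left cinner_diff_right cinner_smult_left cinner_smult_right yx yy
        M.minus_closed a_def algebra_simps)
  also have "\<dots> = cinner H x x - complex_of_real ((cmod a)\<^sup>2 / b)"
    using \<open>b > 0\<close>
    by (simp add: c_def complex_norm_square field_simps del: of_real_power)
  finally have "(cmod a)\<^sup>2 \<le> Re (cinner H x x) * b"
    using \<open>b > 0\<close> by (simp add: field_simps)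
  then have "(cmod a)\<^sup>2 \<le> (cnorm H x * cnorm H y)\<^sup>2"
    using x y by (simp add: power_mult_distrib cnorm_power2 b_def)
  then show ?thesis
    unfolding a_def[symmetric]
    by (rule power2_le_imp_le) (use x y in \<open>simp add: cnorm_nonneg\<close>)
qed

lemma cnorm_triangle:
  assumes x: "x \<in> carrier H" and y: "y \<in> carrier H"
  shows "cnorm H (x \<oplus> y) \<le> cnorm H x + cnorm H y"
proof -
  have xy: "Re (cinner H x y) \<le> cnorm H x * cnorm H y"
    using Cauchy_Schwarz[OF x y] complex_Re_le_cmod[of "cinner H x y"] by linarith
  have yx: "Re (cinner H y x) = Re (cinner H x y)"
    using cinner_commute[OF x y] by simp
  have "(cnorm H (x \<oplus> y))\<^sup>2 = (cnorm H x)\<^sup>2 + 2 * Re (cinner H x y) + (cnorm H y)\<^sup>2"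
    using x y by (simp add: cnorm_power2 cinner_add_left cinner_add_right yx)
  also have "\<dots> \<le> (cnorm H x + cnorm H y)\<^sup>2"
    using xy by (simp add: power2_sum)
  finally show ?thesis
    by (rule power2_le_imp_le) (use x y in \<open>simp add: cnorm_nonneg\<close>)
qed

lemma cnorm_minus_commute:
  assumes "x \<in> carrier H" "y \<in> carrier H"
  shows "cnorm H (x \<ominus> y) = cnorm H (y \<ominus> x)"
  using assms by (simp add: cnorm_def cinner_diff_left cinner_diff_right)

sublocale Metric_space "carrier H" "cdist H"
proof
  fix x y z
  show "0 \<le> cdist H x y"
    by (simp add: cdist_def cnorm_nonneg)
  show "cdist H x y = cdist H y x"
    by (simp add: cdist_def cnorm_minus_commute)
  show "cdist H x y = 0 \<longleftrightarrow> x = y" if "x \<in> carrier H" "y \<in> carrier H"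
    using that by (simp add: cdist_def cnorm_eq_zero_iff diff_eq_zero_iff)
  assume x: "x \<in> carrier H" and y: "y \<in> carrier H" and z: "z \<in> carrier H"
  have "x \<ominus> z = (x \<ominus> y) \<oplus> (y \<ominus> z)"
    using x y z M.a_assoc[of "\<ominus> y" y "\<ominus> z"]
    by (simp add: M.minus_eq M.a_assoc M.l_neg)
  then show "cdist H x z \<le> cdist H x y + cdist H y z"
    using x y z cnorm_triangle[of "x \<ominus> y" "y \<ominus> z"] by (simp add: cdist_def)
qed

end

locale complex_hilbert_space = complex_inner_space +
  assumes complete: "Metric_space.mcomplete (carrier H) (cdist H)"


section \<open>Operators\<close>

definition linear_operator ::
    "('a, 'm) cinner_space_scheme \<Rightarrow> ('b, 'n) cinner_space_scheme \<Rightarrow> ('a \<Rightarrow> 'b) \<Rightarrow> bool"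
  where "linear_operator H K A \<longleftrightarrow>
    A \<in> carrier H \<rightarrow> carrier K \<and>
    (\<forall>x\<in>carrier H. \<forall>y\<in>carrier H. A (x \<oplus>\<^bsub>H\<^esub> y) = A x \<oplus>\<^bsub>K\<^esub> A y) \<and>
    (\<forall>c. \<forall>x\<in>carrier H. A (c \<odot>\<^bsub>H\<^esub> x) = c \<odot>\<^bsub>K\<^esub> A x)"

definition contraction :: "('a, 'm) cinner_space_scheme \<Rightarrow> ('a \<Rightarrow> 'a) \<Rightarrow> bool"
  where "contraction H A \<longleftrightarrow>
    linear_operator H H A \<and> (\<forall>x\<in>carrier H. cnorm H (A x) \<le> cnorm H x)"

definition isometry ::
    "('a, 'm) cinner_space_scheme \<Rightarrow> ('b, 'n) cinner_space_scheme \<Rightarrow> ('a \<Rightarrow> 'b) \<Rightarrow> bool"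
  where "isometry H K r \<longleftrightarrow>
    linear_operator H K r \<and> (\<forall>x\<in>carrier H. cnorm K (r x) = cnorm H x)"

definition unitary :: "('a, 'm) cinner_space_scheme \<Rightarrow> ('a \<Rightarrow> 'a) \<Rightarrow> bool"
  where "unitary H A \<longleftrightarrow>
    linear_operator H H A \<and> A ` carrier H = carrier H \<and>
    (\<forall>x\<in>carrier H. \<forall>y\<in>carrier H. cinner H (A x) (A y) = cinner H x y)"

text \<open>
  For a bounded operator \<open>A\<close> between Hilbert spaces the vector described here exists by the Riesz
  representation theorem; uniqueness is \<open>adjoint_eqI\<close> below.
\<close>

definition adjoint_op ::
    "('a, 'm) cinner_space_scheme \<Rightarrow> ('b, 'n) cinner_space_scheme \<Rightarrow> ('a \<Rightarrow> 'b) \<Rightarrow> 'b \<Rightarrow> 'a"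
  where "adjoint_op H K A y =
    (THE x. x \<in> carrier H \<and> (\<forall>z\<in>carrier H. cinner K (A z) y = cinner H z x))"

lemma (in complex_inner_space) adjoint_eqI:
  assumes x: "x \<in> carrier H"
    and eq: "\<And>z. z \<in> carrier H \<Longrightarrow> cinner K (A z) y = cinner H z x"
  shows "adjoint_op H K A y = x"
  unfolding adjoint_op_def
proof (rule the_equality)
  fix x' assume x': "x' \<in> carrier H \<and> (\<forall>z\<in>carrier H. cinner K (A z) y = cinner H z x')"
  then have "cinner H (x' \<ominus> x) (x' \<ominus> x) = 0"
    using x eq[of "x' \<ominus> x"] cinner_diff_right[of "x' \<ominus> x" x' x] by simp
  then have "cnorm H (x' \<ominus> x) = 0" by (simp add: cnorm_def)
  then show "x' = x" using x x' by (simp add: cnorm_eq_zero_iff diff_eq_zero_iff)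
qed (use assms in auto)

text \<open>Continuity for the strong operator topology is continuity of all orbits.\<close>

definition strongly_continuous_on ::
    "real set \<Rightarrow> ('a, 'm) cinner_space_scheme \<Rightarrow> (real \<Rightarrow> 'a \<Rightarrow> 'a) \<Rightarrow> bool"
  where "strongly_continuous_on S H T \<longleftrightarrow>
    (\<forall>x\<in>carrier H. continuous_map (top_of_set S)
       (Metric_space.mtopology (carrier H) (cdist H)) (\<lambda>t. T t x))"

definition contractive_C0_semigroup ::
    "('a, 'm) cinner_space_scheme \<Rightarrow> (real \<Rightarrow> 'a \<Rightarrow> 'a) \<Rightarrow> bool"
  where "contractive_C0_semigroup H T \<longleftrightarrow>
    (\<forall>t\<ge>0. contraction H (T t)) \<and>
    (\<forall>x\<in>carrier H. T 0 x = x) \<and>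
    (\<forall>s\<ge>0. \<forall>t\<ge>0. \<forall>x\<in>carrier H. T (s + t) x = T s (T t x)) \<and>
    strongly_continuous_on {0..} H T"

definition unitary_representation ::
    "('a, 'm) cinner_space_scheme \<Rightarrow> (real \<Rightarrow> 'a \<Rightarrow> 'a) \<Rightarrow> bool"
  where "unitary_representation H U \<longleftrightarrow>
    (\<forall>t. unitary H (U t)) \<and>
    (\<forall>x\<in>carrier H. U 0 x = x) \<and>
    (\<forall>s t. \<forall>x\<in>carrier H. U (s + t) x = U s (U t x)) \<and>
    strongly_continuous_on UNIV H U"

text \<open>\<open>ordered_prod A N\<close> is the composition \<open>A 1 \<circ> A 2 \<circ> \<dots> \<circ> A N\<close>.\<close>

definition ordered_prod :: "(nat \<Rightarrow> 'a \<Rightarrow> 'a) \<Rightarrow> nat \<Rightarrow> 'a \<Rightarrow> 'a"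
  where "ordered_prod A N = foldr (\<lambda>k B. A k \<circ> B) [1..<Suc N] id"

end

theory Submission
  imports Defs
begin

text \<open>
  One contractive semigroup has a unitary dilation by Sz.-Nagy's theorem. Several of them get
  dilations on one space if their minimal dilations are glued along \<open>H\<close>: take the direct sum of \<open>H\<close>
  and all the orthogonal complements \<open>H\<^sub>i \<ominus> H\<close>, and let \<open>U\<^sub>i\<close> act as the dilation on \<open>H\<^sub>i\<close> and as
  the identity on the other complements. Although the \<open>U\<^sub>i\<close> do not commute, products are dilated
  too: the dilation of \<open>T\<^sub>i\<close> is triangular with respect to the outgoing part of \<open>H\<^sub>i\<close>, and the sum of
  \<open>H\<close> and all outgoing parts is mapped to itself by every \<open>U\<^sub>i(t)\<close> with \<open>t \<ge> 0\<close>, in such a way that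
  the component in \<open>H\<close> is transformed by \<open>T\<^sub>i(t)\<close>.

  The construction is carried out with functions. A vector \<open>v\<close> of the glued space is identified with
  the function \<open>f i s = r\<^sup>* (U\<^sub>i(-s) v)\<close>, so that the space becomes the reproducing kernel Hilbert
  space of the kernel \<open>V\<^sub>i\<^sub>,\<^sub>s\<^sup>* V\<^sub>j\<^sub>,\<^sub>t\<close> with \<open>V\<^sub>i\<^sub>,\<^sub>s = U\<^sub>i(s) r\<close>. This kernel can be written down in terms
  of the semigroups and their adjoints (\<open>kern\<close> and \<open>glued\<close>), and so can the unitaries (\<open>shift\<close>), the
  isometry (\<open>embed\<close>) and its adjoint, which is evaluation at time 0. What has to be proved is the
  following.

  \<^item> Adjoints exist (\<open>Riesz_representation\<close>).
  \<^item> A positive operator-valued kernel has a Hilbert space of functions (\<open>rkhs_complete\<close>,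
    \<open>reproducing\<close>).
  \<^item> The glued kernel is positive. For one semigroup this follows from contractivity by induction
    over increasing times (\<open>kform_sorted\<close>); gluing needs that the kernel remains positive when
    the part in \<open>H\<close> is subtracted (\<open>kform_ge_anchor\<close>).
  \<^item> The shifts are strongly continuous unitary groups (\<open>unitary_representation_shift\<close>).
  \<^item> On functions with \<open>f i (-s) = T\<^sub>i(s) x\<close> for all \<open>i\<close> and \<open>s \<ge> 0\<close>, shifting by \<open>h \<ge> 0\<close>
    replaces \<open>x\<close> by \<open>T\<^sub>i(h) x\<close> (\<open>shift_outgoing\<close>). Iterating this from \<open>r x\<close> gives the product formula.
\<close>

section \<open>Vectors, strong continuity and adjoints\<close>

lemma atin_within_euclidean: "atin_within euclidean a S = at a within S"
  by (intro filter_eqI) (auto simp: eventually_atin_within eventually_at_topological)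

context complex_inner_space
begin

lemma smult_in_carrier [simp, intro]: "x \<in> carrier H \<Longrightarrow> c \<odot> x \<in> carrier H"
  using smult_closed by simp

lemma smult_laws:
  assumes "x \<in> carrier H"
  shows "(a + b) \<odot> x = a \<odot> x \<oplus> b \<odot> x" "(a * b) \<odot> x = a \<odot> (b \<odot> x)" "1 \<odot> x = x"
  using smult_l_distr[of a b x] smult_assoc1[of a b x] smult_one[of x] assms by simp_all

lemmas cinner_simps =
  cinner_add_left cinner_add_right cinner_diff_left cinner_diff_right cinner_minus_left
  cinner_minus_right cinner_smult_left cinner_smult_right cinner_zero_left cinner_zero_right

lemma vector_eqI:
  assumes "x \<in> carrier H" "y \<in> carrier H"
    and "\<And>z. z \<in> carrier H \<Longrightarrow> cinner H x z = cinner H y z"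
  shows "x = y"
proof -
  have "cinner H (x \<ominus> y) (x \<ominus> y) = 0"
    using assms by (simp add: cinner_simps)
  then show ?thesis
    using assms cinner_eq_zeroD[of "x \<ominus> y"] diff_eq_zero_iff by simp
qed

lemma cnorm_smult: "x \<in> carrier H \<Longrightarrow> cnorm H (c \<odot> x) = cmod c * cnorm H x"
  by (simp add: cnorm_def cinner_simps complex_mod_sqrt_Re_mult_cnj
      flip: mult.assoc real_sqrt_mult)

lemma cnorm_diff_triangle:
  assumes "x \<in> carrier H" "y \<in> carrier H" "z \<in> carrier H"
  shows "cnorm H (x \<ominus> z) \<le> cnorm H (x \<ominus> y) + cnorm H (y \<ominus> z)"
  using triangle[of x y z] assms by (simp add: cdist_def)

lemma cnorm_diff_power2:
  assumes "x \<in> carrier H" "y \<in> carrier H"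
  shows "(cnorm H (x \<ominus> y))\<^sup>2 = (cnorm H x)\<^sup>2 - 2 * Re (cinner H x y) + (cnorm H y)\<^sup>2"
  using assms cinner_commute[of y x]
  by (simp add: cnorm_power2 cinner_simps algebra_simps)

definition vsum :: "('x \<Rightarrow> 'a) \<Rightarrow> 'x list \<Rightarrow> 'a"
  where "vsum f l = foldr (\<lambda>a v. f a \<oplus> v) l \<zero>"

lemma vsum_simps [simp]: "vsum f [] = \<zero>" "vsum f (a # l) = f a \<oplus> vsum f l"
  by (simp_all add: vsum_def)

lemma vsum_closed: "(\<And>a. a \<in> set l \<Longrightarrow> f a \<in> carrier H) \<Longrightarrow> vsum f l \<in> carrier H"
  by (induction l) auto

lemma cinner_vsum_left:
  assumes "\<And>a. a \<in> set l \<Longrightarrow> f a \<in> carrier H" "y \<in> carrier H"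
  shows "cinner H (vsum f l) y = (\<Sum>a\<leftarrow>l. cinner H (f a) y)"
  using assms by (induction l) (auto simp: cinner_simps vsum_closed)

lemma cinner_vsum_right:
  assumes "\<And>a. a \<in> set l \<Longrightarrow> f a \<in> carrier H" "y \<in> carrier H"
  shows "cinner H y (vsum f l) = (\<Sum>a\<leftarrow>l. cinner H y (f a))"
  using assms by (induction l) (auto simp: cinner_simps vsum_closed)

lemma strongly_continuous_imp_weakly_continuous:
  assumes "strongly_continuous_on S H T" and x: "x \<in> carrier H" and y: "y \<in> carrier H"
  shows "continuous_on S (\<lambda>t. cinner H (T t x) y)"
proof -
  have cont: "continuous_map (top_of_set S) mtopology (\<lambda>t. T t x)"
    using assms by (simp add: strongly_continuous_on_def)
  have closed: "T t x \<in> carrier H" if "t \<in> S" for t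
    using continuous_map_image_subset_topspace[OF cont] that by auto
  show "continuous_on S (\<lambda>t. cinner H (T t x) y)"
    unfolding continuous_on_def
  proof
    fix a assume a: "a \<in> S"
    have "limitin mtopology (\<lambda>t. T t x) (T a x) (at a within S)"
      using limit_continuous_map_within[OF cont a] by (simp add: atin_within_euclidean)
    then have lim: "((\<lambda>t. cdist H (T t x) (T a x)) \<longlongrightarrow> 0) (at a within S)"
      by (simp add: limitin_metric_dist_null)
    have "((\<lambda>t. cinner H (T t x) y - cinner H (T a x) y) \<longlongrightarrow> 0) (at a within S)"
    proof (rule Lim_null_comparison)
      show "\<forall>\<^sub>F t in at a within S. cmod (cinner H (T t x) y - cinner H (T a x) y)
          \<le> cdist H (T t x) (T a x) * cnorm H y"
        unfolding eventually_at_filter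
        using Cauchy_Schwarz[where y = y] closed a y
        by (intro always_eventually) (auto simp: cdist_def simp flip: cinner_diff_left)
      show "((\<lambda>t. cdist H (T t x) (T a x) * cnorm H y) \<longlongrightarrow> 0) (at a within S)"
        using tendsto_mult_left_zero[OF lim] .
    qed
    then show "((\<lambda>t. cinner H (T t x) y) \<longlongrightarrow> cinner H (T a x) y) (at a within S)"
      by (simp add: LIM_zero_iff)
  qed
qed

lemma strongly_continuous_onI:
  assumes "\<And>t x. x \<in> carrier H \<Longrightarrow> T t x \<in> carrier H"
    and "\<And>x a. x \<in> carrier H \<Longrightarrow> ((\<lambda>t. cnorm H (T t x \<ominus> T a x)) \<longlongrightarrow> 0) (at a)"
  shows "strongly_continuous_on UNIV H T"
  unfolding strongly_continuous_on_def
proof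
  fix x assume x: "x \<in> carrier H"
  have "limitin mtopology (\<lambda>t. T t x) (T a x) (at a)" for a
    using assms x by (simp add: limitin_metric_dist_null cdist_def)
  then show "continuous_map (top_of_set UNIV) mtopology (\<lambda>t. T t x)"
    by (simp add: continuous_map_atin atin_within_euclidean)
qed

end

context complex_hilbert_space
begin

lemma norm_Cauchy_converges:
  assumes closed: "\<And>n. \<sigma> n \<in> carrier H"
    and Cauchy: "\<And>e. e > 0 \<Longrightarrow> \<exists>N. \<forall>m\<ge>N. \<forall>n\<ge>N. cnorm H (\<sigma> m \<ominus> \<sigma> n) < e"
  shows "\<exists>x\<in>carrier H. (\<lambda>n. cnorm H (\<sigma> n \<ominus> x)) \<longlonglongrightarrow> 0"
proof -
  have "MCauchy \<sigma>"
    unfolding MCauchy_def using closed Cauchy by (fastforce simp: cdist_def)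
  then obtain x where "limitin mtopology \<sigma> x sequentially"
    using complete unfolding mcomplete_def by blast
  then show ?thesis
    using closed by (auto simp: limitin_metric_dist_null cdist_def)
qed

text \<open>The Riesz representation theorem. The representing vector minimizes
  \<open>J z = \<parallel>z\<parallel>\<^sup>2 - 2 Re (\<phi> z)\<close>: the parallelogram law makes every minimizing sequence Cauchy, and the
  first variation of \<open>J\<close> at the minimum gives the representation.\<close>

lemma Riesz_representation:
  fixes \<phi> :: "'a \<Rightarrow> complex"
  assumes add: "\<And>x y. x \<in> carrier H \<Longrightarrow> y \<in> carrier H \<Longrightarrow> \<phi> (x \<oplus> y) = \<phi> x + \<phi> y"
    and smult: "\<And>c x. x \<in> carrier H \<Longrightarrow> \<phi> (c \<odot> x) = c * \<phi> x"
    and bounded: "\<And>x. x \<in> carrier H \<Longrightarrow> cmod (\<phi> x) \<le> B * cnorm H x"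
  shows "\<exists>w\<in>carrier H. \<forall>z\<in>carrier H. \<phi> z = cinner H z w"
proof -
  define J where "J z = (cnorm H z)\<^sup>2 - 2 * Re (\<phi> z)" for z
  define j where "j = Inf (J ` carrier H)"
  have J_ge: "J z \<ge> - B\<^sup>2" if "z \<in> carrier H" for z
  proof -
    have "Re (\<phi> z) \<le> B * cnorm H z"
      using bounded[OF that] complex_Re_le_cmod[of "\<phi> z"] by linarith
    moreover have "0 \<le> (cnorm H z - B)\<^sup>2" by simp
    ultimately show ?thesis
      unfolding J_def power2_diff by (simp add: mult.commute)
  qed
  then have bdd: "bdd_below (J ` carrier H)"
    unfolding bdd_below_def by blast
  have j_le: "j \<le> J z" if "z \<in> carrier H" for z
    unfolding j_def using bdd that by (rule cINF_lower)
  have "\<exists>z\<in>carrier H. J z < j + 1 / (real n + 1)" for n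
  proof -
    have "\<exists>y\<in>J ` carrier H. y < j + 1 / (real n + 1)"
      unfolding j_def by (rule cInf_lessD) auto
    then show ?thesis by blast
  qed
  then obtain \<sigma> where \<sigma>: "\<And>n. \<sigma> n \<in> carrier H" "\<And>n. J (\<sigma> n) < j + 1 / (real n + 1)"
    by metis
  have parallelogram: "(cnorm H (u \<ominus> v))\<^sup>2 \<le> 2 * (J u - j) + 2 * (J v - j)"
    if "u \<in> carrier H" "v \<in> carrier H" for u v
  proof -
    have "j \<le> J ((1 / 2) \<odot> (u \<oplus> v))"
      using that by (intro j_le) auto
    also have "\<dots> = (cnorm H (u \<oplus> v))\<^sup>2 / 4 - Re (\<phi> u) - Re (\<phi> v)"
      using that by (simp add: J_def cnorm_smult power_divide smult add norm_divide
          add_divide_distrib)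
    also have "(cnorm H (u \<oplus> v))\<^sup>2 = 2 * (cnorm H u)\<^sup>2 + 2 * (cnorm H v)\<^sup>2 - (cnorm H (u \<ominus> v))\<^sup>2"
      using that by (simp add: cnorm_power2 cinner_simps)
    finally show ?thesis
      by (simp add: J_def field_simps)
  qed
  have "\<exists>w\<in>carrier H. (\<lambda>n. cnorm H (\<sigma> n \<ominus> w)) \<longlonglongrightarrow> 0"
  proof (rule norm_Cauchy_converges)
    fix e :: real assume "e > 0"
    then obtain N where N: "1 / (real N + 1) < e\<^sup>2 / 4"
      using reals_Archimedean[of "e\<^sup>2 / 4"] by (auto simp: inverse_eq_divide add.commute)
    have "cnorm H (\<sigma> m \<ominus> \<sigma> n) < e" if "m \<ge> N" "n \<ge> N" for m n
    proof -
      have "1 / (real k + 1) \<le> 1 / (real N + 1)" if "k \<ge> N" for k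
        using that by (simp add: frac_le)
      then have "J (\<sigma> m) - j < e\<^sup>2 / 4" "J (\<sigma> n) - j < e\<^sup>2 / 4"
        using \<sigma>(2)[of m] \<sigma>(2)[of n] that N by fastforce+
      then have "2 * (J (\<sigma> m) - j) + 2 * (J (\<sigma> n) - j) < e\<^sup>2"
        by (simp add: field_simps)
      then have "(cnorm H (\<sigma> m \<ominus> \<sigma> n))\<^sup>2 < e\<^sup>2"
        by (rule le_less_trans[OF parallelogram[OF \<sigma>(1) \<sigma>(1)]])
      then show ?thesis
        using \<open>e > 0\<close> by (simp add: power2_less_imp_less)
    qed
    then show "\<exists>N. \<forall>m\<ge>N. \<forall>n\<ge>N. cnorm H (\<sigma> m \<ominus> \<sigma> n) < e" by blast
  qed (rule \<sigma>)
  then obtain w where w: "w \<in> carrier H" "(\<lambda>n. cnorm H (\<sigma> n \<ominus> w)) \<longlonglongrightarrow> 0"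
    by blast
  have J_shift: "J (w \<oplus> x) = J w + (cnorm H x)\<^sup>2 + 2 * Re (cinner H x w) - 2 * Re (\<phi> x)"
    if "x \<in> carrier H" for x
    using that w(1) cinner_commute[of w x] by (simp add: J_def cnorm_power2 cinner_simps add)
  \<comment> \<open>The zeros are the limits of the two error terms in \<open>J w \<le> J (\<sigma> n) + \<dots>\<close>.\<close>
  have "J w \<le> j + 0 + 0"
  proof (rule LIMSEQ_le)
    let ?d = "\<lambda>n. cnorm H (\<sigma> n \<ominus> w)"
    show "(\<lambda>n. J (\<sigma> n) + 2 * (?d n * cnorm H w) + 2 * (B * ?d n)) \<longlonglongrightarrow> j + 0 + 0"
    proof (intro tendsto_add)
      have "(\<lambda>n. j + 1 / (real n + 1)) \<longlonglongrightarrow> j + 0"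
        by (intro tendsto_add tendsto_const lim_1_over_n[THEN LIMSEQ_Suc, simplified add.commute])
          (use LIMSEQ_inverse_real_of_nat in \<open>simp add: inverse_eq_divide add.commute\<close>)
      then show "(\<lambda>n. J (\<sigma> n)) \<longlonglongrightarrow> j"
        using \<sigma> j_le
        by (intro tendsto_sandwich[of "\<lambda>_. j" "\<lambda>n. J (\<sigma> n)" _ "\<lambda>n. j + 1 / (real n + 1)"])
          (auto intro!: always_eventually less_imp_le)
      show "(\<lambda>n. 2 * (?d n * cnorm H w)) \<longlonglongrightarrow> 0" "(\<lambda>n. 2 * (B * ?d n)) \<longlonglongrightarrow> 0"
        using w(2) by (auto intro!: tendsto_eq_intros)
    qed
    show "\<exists>N. \<forall>n\<ge>N. J w \<le> J (\<sigma> n) + 2 * (?d n * cnorm H w) + 2 * (B * ?d n)"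
    proof (intro exI allI impI)
      fix n :: nat
      have x: "\<sigma> n \<ominus> w \<in> carrier H" using \<sigma> w by simp
      have "w \<oplus> (\<sigma> n \<ominus> w) = \<sigma> n"
        using \<sigma>(1)[of n] w(1) by (intro vector_eqI) (auto simp: cinner_simps)
      then have "J (\<sigma> n) = J w + (?d n)\<^sup>2 + 2 * Re (cinner H (\<sigma> n \<ominus> w) w) - 2 * Re (\<phi> (\<sigma> n \<ominus> w))"
        using J_shift[OF x] by simp
      moreover have "- Re (cinner H (\<sigma> n \<ominus> w) w) \<le> ?d n * cnorm H w"
        using Cauchy_Schwarz[OF x w(1)] abs_Re_le_cmod[of "cinner H (\<sigma> n \<ominus> w) w"] by linarith
      moreover have "Re (\<phi> (\<sigma> n \<ominus> w)) \<le> B * ?d n"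
        using bounded[OF x] complex_Re_le_cmod[of "\<phi> (\<sigma> n \<ominus> w)"] by linarith
      ultimately show "J w \<le> J (\<sigma> n) + 2 * (?d n * cnorm H w) + 2 * (B * ?d n)"
        using zero_le_power2[of "?d n"] by linarith
    qed
  qed simp
  have "\<phi> z = cinner H z w" if z: "z \<in> carrier H" for z
  proof -
    define a where "a = \<phi> z - cinner H z w"
    define b where "b = (cnorm H z)\<^sup>2 + 1"
    have b: "b > 0" unfolding b_def by (simp add: add_nonneg_pos)
    \<comment> \<open>The step \<open>c \<odot> z\<close> away from \<open>w\<close> changes \<open>J\<close> by at most \<open>- \<bar>a\<bar>\<^sup>2 / b\<close>; the summand 1 keeps \<open>b\<close>
      positive if \<open>z = \<zero>\<close>.\<close>
    define c where "c = cnj a / b"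
    have ca: "Re (c * a) = (cmod a)\<^sup>2 / b"
      by (simp add: c_def cmod_power2 flip: power2_eq_square)
    have "J w \<le> J (w \<oplus> c \<odot> z)"
      using \<open>J w \<le> j + 0 + 0\<close> j_le[of "w \<oplus> c \<odot> z"] w z by simp
    also have "\<dots> = J w + (cmod c)\<^sup>2 * (cnorm H z)\<^sup>2 - 2 * Re (c * a)"
      using z w by (simp add: J_shift cnorm_smult power_mult_distrib cinner_simps smult a_def
          algebra_simps)
    also have "(cmod c)\<^sup>2 = (cmod a)\<^sup>2 / b\<^sup>2"
      using b by (simp add: c_def norm_divide power_divide)
    finally have "2 * ((cmod a)\<^sup>2 / b) \<le> (cmod a)\<^sup>2 / b\<^sup>2 * (cnorm H z)\<^sup>2"
      using ca by simp
    also have "\<dots> \<le> (cmod a)\<^sup>2 / b\<^sup>2 * b"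
      unfolding b_def by (intro mult_left_mono) auto
    also have "\<dots> = (cmod a)\<^sup>2 / b"
      using b by (simp add: power2_eq_square)
    finally have "(cmod a)\<^sup>2 \<le> 0"
      using b by (simp add: field_simps)
    then show ?thesis by (simp add: a_def)
  qed
  then show ?thesis using w(1) by blast
qed

lemma contraction_adjoint:
  assumes A: "contraction H A" and y: "y \<in> carrier H"
  shows "adjoint_op H H A y \<in> carrier H"
    and "x \<in> carrier H \<Longrightarrow> cinner H (A x) y = cinner H x (adjoint_op H H A y)"
proof -
  have closed: "A x \<in> carrier H" if "x \<in> carrier H" for x
    using A that by (auto simp: contraction_def linear_operator_def)
  have "\<exists>w\<in>carrier H. \<forall>z\<in>carrier H. cinner H (A z) y = cinner H z w"
  proof (rule Riesz_representation[where B = "cnorm H y"])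
    fix x assume x: "x \<in> carrier H"
    have "cmod (cinner H (A x) y) \<le> cnorm H (A x) * cnorm H y"
      using closed x y by (simp add: Cauchy_Schwarz)
    also have "\<dots> \<le> cnorm H x * cnorm H y"
      using A x y by (intro mult_right_mono) (auto simp: contraction_def cnorm_nonneg)
    finally show "cmod (cinner H (A x) y) \<le> cnorm H y * cnorm H x"
      by (simp add: mult.commute)
  qed (use A y closed in \<open>auto simp: contraction_def linear_operator_def cinner_simps\<close>)
  then obtain w where w: "w \<in> carrier H" "\<forall>z\<in>carrier H. cinner H (A z) y = cinner H z w"
    by blast
  then have "adjoint_op H H A y = w"
    by (intro adjoint_eqI) auto
  with w show "adjoint_op H H A y \<in> carrier H"
    and "x \<in> carrier H \<Longrightarrow> cinner H (A x) y = cinner H x (adjoint_op H H A y)"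
    by auto
qed

end


section \<open>The Hilbert space of an operator-valued kernel\<close>

text \<open>
  The model is \<open>K i s j t = V\<^sub>i\<^sub>,\<^sub>s\<^sup>* V\<^sub>j\<^sub>,\<^sub>t\<close> for operators \<open>V\<^sub>i\<^sub>,\<^sub>s\<close> from \<open>H\<close> to another Hilbert space, and
  \<open>K_diagonal\<close> says that they are isometric. The points are pairs \<open>(i, s)\<close>, taken as two separate
  arguments so that the vectors of the constructed space are functions of type \<open>'p \<Rightarrow> 'q \<Rightarrow> 'a\<close>. Linearity
  of \<open>K i s j t\<close> follows from the existence of an adjoint.
\<close>

locale operator_kernel = complex_hilbert_space H
  for H :: "('a, 'm) cinner_space_scheme" (structure) +
  fixes K :: "'p \<Rightarrow> 'q \<Rightarrow> 'p \<Rightarrow> 'q \<Rightarrow> 'a \<Rightarrow> 'a"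
  assumes K_closed [simp, intro]: "x \<in> carrier H \<Longrightarrow> K i s j t x \<in> carrier H"
    and K_adjoint: "\<lbrakk>x \<in> carrier H; y \<in> carrier H\<rbrakk>
      \<Longrightarrow> cinner H (K i s j t x) y = cinner H x (K j t i s y)"
    and K_diagonal: "x \<in> carrier H \<Longrightarrow> K i s i s x = x"
    and K_positive: "\<forall>(j, t, x)\<in>set l. x \<in> carrier H
      \<Longrightarrow> 0 \<le> Re (\<Sum>(j, t, x)\<leftarrow>l. \<Sum>(i, s, y)\<leftarrow>l. cinner H (K i s j t x) y)"
begin

subsection \<open>Formal combinations of kernel functions\<close>

text \<open>
  A list of triples \<open>(j, t, x)\<close> stands for the formal sum of the vectors \<open>V\<^sub>j\<^sub>,\<^sub>t x\<close>. Then \<open>comb\<close> is the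
  function that represents this sum, and \<open>form\<close> is the inner product of two such sums. Working with
  lists avoids showing that the inner product depends on the functions alone before it is available.
\<close>

definition valid :: "('p \<times> 'q \<times> 'a) list \<Rightarrow> bool"
  where "valid l \<longleftrightarrow> (\<forall>(j, t, x)\<in>set l. x \<in> carrier H)"

definition comb :: "('p \<times> 'q \<times> 'a) list \<Rightarrow> 'p \<Rightarrow> 'q \<Rightarrow> 'a"
  where "comb l i s = vsum (\<lambda>(j, t, x). K i s j t x) l"

definition form :: "('p \<times> 'q \<times> 'a) list \<Rightarrow> ('p \<times> 'q \<times> 'a) list \<Rightarrow> complex"
  where "form l m = (\<Sum>(j, t, x)\<leftarrow>l. \<Sum>(i, s, y)\<leftarrow>m. cinner H (K i s j t x) y)"

definition scale :: "complex \<Rightarrow> ('p \<times> 'q \<times> 'a) list \<Rightarrow> ('p \<times> 'q \<times> 'a) list"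
  where "scale c l = map (\<lambda>(j, t, x). (j, t, c \<odot> x)) l"

definition nrm :: "('p \<times> 'q \<times> 'a) list \<Rightarrow> real"
  where "nrm l = sqrt (Re (form l l))"

definition gap :: "('p \<times> 'q \<times> 'a) list \<Rightarrow> ('p \<times> 'q \<times> 'a) list \<Rightarrow> real"
  where "gap l m = nrm (l @ scale (- 1) m)"

lemma K_smult: "x \<in> carrier H \<Longrightarrow> K i s j t (c \<odot> x) = c \<odot> K i s j t x"
  by (rule vector_eqI) (auto simp: K_adjoint cinner_simps)

lemma valid_simps [simp]:
  "valid []"
  "valid ((j, t, x) # l) \<longleftrightarrow> x \<in> carrier H \<and> valid l"
  "valid (l @ m) \<longleftrightarrow> valid l \<and> valid m"
  by (simp_all add: valid_def ball_Un)

lemma valid_scale [simp]: "valid l \<Longrightarrow> valid (scale c l)"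
  by (auto simp: valid_def scale_def)

lemma comb_simps [simp]:
  "comb [] i s = \<zero>"
  "comb ((j, t, x) # l) i s = K i s j t x \<oplus> comb l i s"
  by (simp_all add: comb_def)

lemma comb_closed [simp, intro]: "valid l \<Longrightarrow> comb l i s \<in> carrier H"
  by (induction l) auto

lemma form_Nil [simp]: "form [] m = 0" "form l [] = 0"
  by (simp_all add: form_def case_prod_unfold)

lemma form_Cons_left: "form (a # l) m = form [a] m + form l m"
  by (simp add: form_def)

lemma form_Cons_right: "form l (b # m) = form l [b] + form l m"
  by (simp add: form_def case_prod_unfold sum_list_addf)

lemma form_append:
  "form (l @ l') m = form l m + form l' m"
  "form l (m @ m') = form l m + form l m'"
  by (simp_all add: form_def case_prod_unfold sum_list_addf)

text \<open>
  The reproducing property for combinations: a value of \<open>comb l\<close>, tested against \<open>y\<close>, is an inner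
  product with a one-element combination.
\<close>

lemma form_single_right:
  assumes "valid l" "y \<in> carrier H"
  shows "form l [(i, s, y)] = cinner H (comb l i s) y"
  using assms
proof (induction l)
  case (Cons a l)
  then show ?case
    by (cases a) (simp add: form_Cons_left[of a l] cinner_simps, simp add: form_def)
qed (simp add: cinner_simps)

lemma form_commute: "valid l \<Longrightarrow> valid m \<Longrightarrow> form l m = cnj (form m l)"
proof (induction l)
  case (Cons a l)
  obtain j t x where a: "a = (j, t, x)" by (cases a)
  have "form [a] m = cnj (form m [a])"
    using \<open>valid m\<close>
  proof (induction m)
    case (Cons b m)
    then show ?case
      using \<open>valid (a # l)\<close> cinner_commute[of x]
      by (cases b) (simp add: form_Cons_left[of b m] form_Cons_right[of "[a]" b m] a,
          simp add: form_def K_adjoint)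
  qed simp
  then show ?case
    using Cons by (simp add: a form_Cons_left[of _ l] form_Cons_right[of m _ l])
qed simp

lemma form_scale_left: "valid l \<Longrightarrow> valid m \<Longrightarrow> form (scale c l) m = c * form l m"
proof (induction l)
  case (Cons a l)
  obtain j t x where a: "a = (j, t, x)" by (cases a)
  have "form [(j, t, c \<odot> x)] m = c * form [a] m"
    using \<open>valid m\<close>
  proof (induction m)
    case (Cons b m)
    then show ?case
      using \<open>valid (a # l)\<close>
      by (cases b) (simp add: form_Cons_right[of _ b m] a, simp add: form_def K_smult cinner_simps
          distrib_left)
  qed simp
  moreover have "scale c (a # l) = (j, t, c \<odot> x) # scale c l"
    by (simp add: scale_def a)
  ultimately show ?case
    using Cons by (simp add: a form_Cons_left[of _ "scale c l"] form_Cons_left[of _ l] distrib_left)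
qed (simp add: scale_def)

lemma form_scale_right: "valid l \<Longrightarrow> valid m \<Longrightarrow> form l (scale c m) = cnj c * form l m"
  using form_commute[of l "scale c m"] form_commute[of l m] form_scale_left[of m l c] by simp

lemmas form_simps = form_append form_scale_left form_scale_right

lemma cinner_comb_append:
  assumes "valid l" "valid m" "y \<in> carrier H"
  shows "cinner H (comb (l @ m) i s) y = cinner H (comb l i s) y + cinner H (comb m i s) y"
  using assms by (simp add: form_simps flip: form_single_right)

lemma cinner_comb_scale:
  assumes "valid l" "y \<in> carrier H"
  shows "cinner H (comb (scale c l) i s) y = c * cinner H (comb l i s) y"
  using assms by (simp add: form_simps flip: form_single_right)

lemma form_nonneg: "valid l \<Longrightarrow> 0 \<le> Re (form l l)"
  unfolding form_def by (rule K_positive) (simp add: valid_def)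

lemma form_self: "valid l \<Longrightarrow> form l l = complex_of_real ((nrm l)\<^sup>2)"
  using form_commute[of l l] by (simp add: complex_eq_iff nrm_def form_nonneg)

lemma nrm_nonneg: "valid l \<Longrightarrow> 0 \<le> nrm l"
  by (simp add: nrm_def form_nonneg)

text \<open>The form is only positive semidefinite on formal combinations, so the second argument may
  have norm zero; the quadratic below is then linear and must be constant.\<close>

lemma form_Cauchy_Schwarz:
  assumes "valid l" "valid m"
  shows "cmod (form l m) \<le> nrm l * nrm m"
proof -
  define z where "z = form l m"
  have ml: "form m l = cnj z"
    using form_commute[of m l] assms by (simp add: z_def)
  \<comment> \<open>positivity of the form on \<open>l - r z m\<close>\<close>
  have quadratic: "0 \<le> (nrm l)\<^sup>2 - 2 * r * (cmod z)\<^sup>2 + r\<^sup>2 * (cmod z)\<^sup>2 * (nrm m)\<^sup>2" for r :: real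
  proof -
    have "0 \<le> Re (form (l @ scale (- (r * z)) m) (l @ scale (- (r * z)) m))"
      using assms by (intro form_nonneg) simp
    also have "form (l @ scale (- (r * z)) m) (l @ scale (- (r * z)) m) =
        complex_of_real ((nrm l)\<^sup>2) - 2 * r * (z * cnj z) + r\<^sup>2 * (z * cnj z) * (nrm m)\<^sup>2"
      using assms
      by (simp add: form_simps form_self[OF assms(1)] form_self[OF assms(2)] ml flip: z_def) (simp add: algebra_simps power2_eq_square)
    also have "z * cnj z = complex_of_real ((cmod z)\<^sup>2)"
      by (rule complex_norm_square[symmetric])
    finally show ?thesis by (simp flip: of_real_power of_real_mult)
  qed
  have "(cmod z)\<^sup>2 \<le> (nrm l * nrm m)\<^sup>2"
  proof (cases "nrm m = 0")
    case True
    have "cmod z = 0"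
    proof (rule ccontr)
      assume "cmod z \<noteq> 0"
      then show False
        using quadratic[of "((nrm l)\<^sup>2 + 1) / (2 * (cmod z)\<^sup>2)"] by (simp add: True)
    qed
    then show ?thesis by simp
  next
    case False
    then have "0 \<le> (nrm l)\<^sup>2 - (cmod z)\<^sup>2 / (nrm m)\<^sup>2"
      using quadratic[of "1 / (nrm m)\<^sup>2"] by (simp add: field_simps)
    then show ?thesis
      using False by (simp add: pos_divide_le_eq power_mult_distrib)
  qed
  then show ?thesis
    unfolding z_def[symmetric]
    by (rule power2_le_imp_le) (use assms in \<open>simp add: nrm_nonneg\<close>)
qed

lemma nrm_append:
  assumes "valid l" "valid m"
  shows "nrm (l @ m) \<le> nrm l + nrm m"
proof -
  have "Re (form l m) \<le> nrm l * nrm m"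
    using form_Cauchy_Schwarz[OF assms] complex_Re_le_cmod[of "form l m"] by linarith
  moreover have "Re (form m l) = Re (form l m)"
    using form_commute[of l m] assms by simp
  moreover have "(nrm (l @ m))\<^sup>2 = (nrm l)\<^sup>2 + Re (form l m) + Re (form m l) + (nrm m)\<^sup>2"
    using assms by (simp add: nrm_def form_nonneg form_simps)
      (use form_nonneg[of "l @ m"] assms in \<open>simp add: form_simps\<close>)
  ultimately have "(nrm (l @ m))\<^sup>2 \<le> (nrm l + nrm m)\<^sup>2"
    by (simp add: power2_sum)
  then show ?thesis
    by (rule power2_le_imp_le) (use assms in \<open>simp add: nrm_nonneg\<close>)
qed

lemma nrm_le_gap:
  assumes "valid l" "valid m"
  shows "nrm l \<le> nrm m + gap l m"
proof -
  have "nrm l = nrm (m @ (l @ scale (- 1) m))"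
    using assms by (simp add: nrm_def form_simps)
  also have "\<dots> \<le> nrm m + gap l m"
    unfolding gap_def using assms by (intro nrm_append) auto
  finally show ?thesis .
qed

lemma gap_nonneg: "valid l \<Longrightarrow> valid m \<Longrightarrow> 0 \<le> gap l m"
  by (simp add: gap_def nrm_nonneg)

lemma form_diff_left:
  assumes "valid l" "valid l'" "valid m"
  shows "cmod (form l m - form l' m) \<le> gap l l' * nrm m"
  using form_Cauchy_Schwarz[of "l @ scale (- 1) l'" m] assms by (simp add: form_simps gap_def)

lemma form_diff_right:
  assumes "valid l" "valid m" "valid m'"
  shows "cmod (form l m - form l m') \<le> nrm l * gap m m'"
  using form_Cauchy_Schwarz[of l "m @ scale (- 1) m'"] assms by (simp add: form_simps gap_def)

text \<open>
  Evaluation at a point is \<open>V\<^sub>i\<^sub>,\<^sub>s\<^sup>*\<close>, the adjoint of an isometry, hence contractive.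
\<close>

lemma cnorm_comb_le:
  assumes "valid l"
  shows "cnorm H (comb l i s) \<le> nrm l"
proof -
  let ?v = "comb l i s"
  have v: "?v \<in> carrier H" using assms by simp
  have "nrm [(i, s, ?v)] = cnorm H ?v"
    using v by (simp add: nrm_def cnorm_def form_def K_diagonal)
  moreover have "Re (form l [(i, s, ?v)]) = (cnorm H ?v)\<^sup>2"
    using assms v by (simp add: form_single_right cnorm_power2)
  ultimately have "(cnorm H ?v)\<^sup>2 \<le> nrm l * cnorm H ?v"
    using form_Cauchy_Schwarz[of l "[(i, s, ?v)]"] assms v
      complex_Re_le_cmod[of "form l [(i, s, ?v)]"] by simp
  then show ?thesis
    using cnorm_nonneg[OF v] nrm_nonneg[OF assms]
    by (cases "cnorm H ?v = 0") (auto simp: power2_eq_square)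
qed


subsection \<open>The completion as a space of functions\<close>

definition Cauchy_combs :: "(nat \<Rightarrow> ('p \<times> 'q \<times> 'a) list) \<Rightarrow> bool"
  where "Cauchy_combs c \<longleftrightarrow> (\<forall>n. valid (c n)) \<and>
    (\<forall>e>0. \<exists>N. \<forall>m\<ge>N. \<forall>n\<ge>N. gap (c m) (c n) < e)"

text \<open>
  Pointwise convergence is only required weakly in \<open>H\<close>: this passes to sums, multiples and shifts by
  limit rules for complex numbers, and for Cauchy sequences it amounts to the same.
\<close>

definition approx :: "('p \<Rightarrow> 'q \<Rightarrow> 'a) \<Rightarrow> (nat \<Rightarrow> ('p \<times> 'q \<times> 'a) list) \<Rightarrow> bool"
  where "approx f c \<longleftrightarrow> Cauchy_combs c \<and>
    (\<forall>i s. f i s \<in> carrier H \<and>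
      (\<forall>y\<in>carrier H. (\<lambda>n. cinner H (comb (c n) i s) y) \<longlonglongrightarrow> cinner H (f i s) y))"

lemma approxD:
  assumes "approx f c"
  shows "valid (c n)" and "f i s \<in> carrier H"
    and "y \<in> carrier H \<Longrightarrow> (\<lambda>n. cinner H (comb (c n) i s) y) \<longlonglongrightarrow> cinner H (f i s) y"
    and "Cauchy_combs c"
  using assms by (auto simp: approx_def Cauchy_combs_def)

lemma Cauchy_combsD:
  assumes "Cauchy_combs c" "e > 0"
  obtains N where "\<And>m n. m \<ge> N \<Longrightarrow> n \<ge> N \<Longrightarrow> gap (c m) (c n) < e"
  using assms unfolding Cauchy_combs_def by blast

lemma Cauchy_combs_bounded:
  assumes "Cauchy_combs c"
  obtains M where "M > 0" "\<forall>\<^sub>F n in sequentially. nrm (c n) \<le> M"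
proof -
  have v: "valid (c n)" for n using assms by (simp add: Cauchy_combs_def)
  obtain N where N: "\<And>m n. m \<ge> N \<Longrightarrow> n \<ge> N \<Longrightarrow> gap (c m) (c n) < 1"
    using Cauchy_combsD[OF assms zero_less_one] by blast
  have "nrm (c n) \<le> nrm (c N) + 1" if "n \<ge> N" for n
    using nrm_le_gap[OF v[of n] v[of N]] N[of n N] that by simp
  then show ?thesis
    using nrm_nonneg[OF v[of N]]
    by (intro that[of "nrm (c N) + 1"]) (auto simp: eventually_sequentially)
qed

lemma Cauchy_combs_append:
  assumes c: "Cauchy_combs c" and d: "Cauchy_combs d"
  shows "Cauchy_combs (\<lambda>n. c n @ d n)"
  unfolding Cauchy_combs_def
proof (intro conjI allI impI)
  have v: "valid (c n)" "valid (d n)" for n using c d by (auto simp: Cauchy_combs_def)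
  then show "valid (c n @ d n)" for n by simp
  fix e :: real assume "e > 0"
  then have e: "e / 2 > 0" by simp
  obtain N where N: "\<And>m n. m \<ge> N \<Longrightarrow> n \<ge> N \<Longrightarrow> gap (c m) (c n) < e / 2"
    using Cauchy_combsD[OF c e] by blast
  obtain N' where N': "\<And>m n. m \<ge> N' \<Longrightarrow> n \<ge> N' \<Longrightarrow> gap (d m) (d n) < e / 2"
    using Cauchy_combsD[OF d e] by blast
  have "gap (c m @ d m) (c n @ d n) \<le> gap (c m) (c n) + gap (d m) (d n)" for m n
  proof -
    have "gap (c m @ d m) (c n @ d n)
        = nrm ((c m @ scale (- 1) (c n)) @ (d m @ scale (- 1) (d n)))"
      using v by (simp add: gap_def nrm_def form_simps algebra_simps)
    also have "\<dots> \<le> gap (c m) (c n) + gap (d m) (d n)"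
      unfolding gap_def using v by (intro nrm_append) auto
    finally show ?thesis .
  qed
  then have "gap (c m @ d m) (c n @ d n) < e" if "m \<ge> max N N'" "n \<ge> max N N'" for m n
    using N[of m n] N'[of m n] that by (smt (verit) field_sum_of_halves max.bounded_iff)
  then show "\<exists>N. \<forall>m\<ge>N. \<forall>n\<ge>N. gap (c m @ d m) (c n @ d n) < e" by blast
qed

lemma Cauchy_combs_scale:
  assumes c: "Cauchy_combs c"
  shows "Cauchy_combs (\<lambda>n. scale a (c n))"
  unfolding Cauchy_combs_def
proof (intro conjI allI impI)
  have v: "valid (c n)" for n using c by (auto simp: Cauchy_combs_def)
  then show "valid (scale a (c n))" for n by simp
  have eq: "gap (scale a (c m)) (scale a (c n)) = cmod a * gap (c m) (c n)" for m n
  proof -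
    have "Re (form (scale a (c m) @ scale (- 1) (scale a (c n)))
          (scale a (c m) @ scale (- 1) (scale a (c n)))) =
        Re (a * cnj a * form (c m @ scale (- 1) (c n)) (c m @ scale (- 1) (c n)))"
      using v by (simp add: form_simps algebra_simps)
    also have "a * cnj a = complex_of_real ((cmod a)\<^sup>2)"
      by (rule complex_norm_square[symmetric])
    finally show ?thesis
      by (simp add: gap_def nrm_def real_sqrt_mult)
  qed
  fix e :: real assume "e > 0"
  have a: "cmod a + 1 > 0" by (simp add: add_nonneg_pos)
  then have e: "e / (cmod a + 1) > 0" using \<open>e > 0\<close> by simp
  obtain N where N: "\<And>m n. m \<ge> N \<Longrightarrow> n \<ge> N \<Longrightarrow> gap (c m) (c n) < e / (cmod a + 1)"
    using Cauchy_combsD[OF c e] by blast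
  have "gap (scale a (c m)) (scale a (c n)) < e" if "m \<ge> N" "n \<ge> N" for m n
  proof -
    have "cmod a * gap (c m) (c n) \<le> (cmod a + 1) * gap (c m) (c n)"
      using gap_nonneg[OF v v] by (intro mult_right_mono) auto
    also have "\<dots> < e"
      using N[OF that] a by (simp add: pos_less_divide_eq mult.commute)
    finally show ?thesis by (simp add: eq)
  qed
  then show "\<exists>N. \<forall>m\<ge>N. \<forall>n\<ge>N. gap (scale a (c m)) (scale a (c n)) < e" by blast
qed

lemma approx_add:
  assumes "approx f c" "approx g d"
  shows "approx (\<lambda>i s. f i s \<oplus> g i s) (\<lambda>n. c n @ d n)"
  using assms approxD[OF assms(1)] approxD[OF assms(2)]
  by (auto simp: approx_def Cauchy_combs_append cinner_comb_append cinner_simps intro!: tendsto_intros)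

lemma approx_smult:
  assumes "approx f c"
  shows "approx (\<lambda>i s. a \<odot> f i s) (\<lambda>n. scale a (c n))"
  using assms approxD[OF assms]
  by (auto simp: approx_def Cauchy_combs_scale cinner_comb_scale cinner_simps intro!: tendsto_intros)

lemma approx_comb: "valid l \<Longrightarrow> approx (comb l) (\<lambda>_. l)"
  by (auto simp: approx_def Cauchy_combs_def gap_def nrm_def form_simps)

lemma approx_zero: "approx (\<lambda>i s. \<zero>) (\<lambda>_. [])"
proof -
  have "comb [] = (\<lambda>i s. \<zero>)" by (intro ext) simp
  then show ?thesis using approx_comb[of "[]"] by simp
qed

lemma approx_diff:
  assumes "approx f c" "approx g d"
  shows "approx (\<lambda>i s. f i s \<ominus> g i s) (\<lambda>n. c n @ scale (- 1) (d n))"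
proof -
  have "(- 1) \<odot> g i s = \<ominus> g i s" for i s
    using approxD(2)[OF assms(2)] by (intro vector_eqI) (auto simp: cinner_simps)
  then show ?thesis
    using approx_add[OF assms(1) approx_smult[OF assms(2), of "- 1"]] by (simp add: M.minus_eq)
qed

text \<open>A Cauchy sequence of combinations that vanishes pointwise in the limit has norms tending to
  zero. This makes the inner product of the limit functions independent of the chosen
  approximation, and it is the reason why the completion consists of functions.\<close>

lemma nrm_tendsto_zero:
  assumes "approx (\<lambda>i s. \<zero>) c"
  shows "(\<lambda>n. nrm (c n)) \<longlonglongrightarrow> 0"
proof (rule LIMSEQ_I)
  note v = approxD(1)[OF assms]
  have weak: "(\<lambda>n. form (c n) m) \<longlonglongrightarrow> 0" if "valid m" for m
    using that
  proof (induction m)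
    case (Cons b m)
    obtain i s y where b: "b = (i, s, y)" by (cases b)
    have "(\<lambda>n. form (c n) [b] + form (c n) m) \<longlonglongrightarrow> 0 + 0"
      using Cons approxD(3)[OF assms, of y i s] v
      by (intro tendsto_add) (auto simp: b form_single_right cinner_simps)
    then show ?case by (simp add: form_Cons_right[of _ b m])
  qed simp
  fix e :: real assume "e > 0"
  obtain M where M: "M > 0" "\<forall>\<^sub>F n in sequentially. nrm (c n) \<le> M"
    using Cauchy_combs_bounded[OF approxD(4)[OF assms]] by blast
  have e: "e\<^sup>2 / (2 * M) > 0" "e\<^sup>2 / 2 > 0" using \<open>e > 0\<close> M by auto
  obtain N where N: "\<And>m n. m \<ge> N \<Longrightarrow> n \<ge> N \<Longrightarrow> gap (c m) (c n) < e\<^sup>2 / (2 * M)"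
    using Cauchy_combsD[OF approxD(4)[OF assms] e(1)] by blast
  have "\<forall>\<^sub>F n in sequentially. cmod (form (c n) (c N)) < e\<^sup>2 / 2"
    using order_tendstoD(2)[OF tendsto_norm_zero[OF weak[OF v[of N]]] e(2)] .
  with M(2) eventually_ge_at_top[of N] have "\<forall>\<^sub>F n in sequentially. norm (nrm (c n) - 0) < e"
  proof eventually_elim
    case (elim n)
    have "(nrm (c n))\<^sup>2 = cmod (form (c n) (c n))"
      using form_self[OF v[of n]] by (simp add: norm_power)
    also have "\<dots> \<le> cmod (form (c n) (c N)) + cmod (form (c n) (c n) - form (c n) (c N))"
      by (metis add.commute diff_add_cancel norm_triangle_ineq)
    also have "cmod (form (c n) (c n) - form (c n) (c N)) \<le> nrm (c n) * gap (c n) (c N)"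
      using v by (rule form_diff_right) (use v in auto)
    also have "\<dots> \<le> M * (e\<^sup>2 / (2 * M))"
      using elim N[of n N] M nrm_nonneg[OF v] gap_nonneg[OF v v]
      by (intro mult_mono) (auto intro: less_imp_le)
    also have "\<dots> = e\<^sup>2 / 2" using M by simp
    finally have "(nrm (c n))\<^sup>2 < e\<^sup>2" using elim by simp
    then show ?case
      using \<open>e > 0\<close> nrm_nonneg[OF v[of n]] by (simp add: power2_less_imp_less)
  qed
  then show "\<exists>no. \<forall>n\<ge>no. norm (nrm (c n) - 0) < e"
    by (simp add: eventually_sequentially)
qed

lemma form_convergent:
  assumes f: "approx f c" and g: "approx g d"
  shows "convergent (\<lambda>n. form (c n) (d n))"
proof (rule Cauchy_convergent, rule CauchyI)
  note v = approxD(1)[OF f] and w = approxD(1)[OF g]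
  fix e :: real assume "e > 0"
  obtain M where M: "M > 0" "\<forall>\<^sub>F n in sequentially. nrm (c n) \<le> M"
    using Cauchy_combs_bounded[OF approxD(4)[OF f]] by blast
  obtain M' where M': "M' > 0" "\<forall>\<^sub>F n in sequentially. nrm (d n) \<le> M'"
    using Cauchy_combs_bounded[OF approxD(4)[OF g]] by blast
  have e: "e / (2 * M') > 0" "e / (2 * M) > 0" using \<open>e > 0\<close> M M' by auto
  obtain N where N: "\<And>m n. m \<ge> N \<Longrightarrow> n \<ge> N \<Longrightarrow> gap (c m) (c n) < e / (2 * M')"
    using Cauchy_combsD[OF approxD(4)[OF f] e(1)] by blast
  obtain N' where N': "\<And>m n. m \<ge> N' \<Longrightarrow> n \<ge> N' \<Longrightarrow> gap (d m) (d n) < e / (2 * M)"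
    using Cauchy_combsD[OF approxD(4)[OF g] e(2)] by blast
  obtain N'' where N'': "\<And>n. n \<ge> N'' \<Longrightarrow> nrm (c n) \<le> M \<and> nrm (d n) \<le> M'"
    using eventually_conj[OF M(2) M'(2)] by (auto simp: eventually_sequentially)
  have "norm (form (c m) (d m) - form (c n) (d n)) < e"
    if "m \<ge> Max {N, N', N''}" "n \<ge> Max {N, N', N''}" for m n
  proof -
    have "cmod (form (c m) (d m) - form (c n) (d m)) \<le> gap (c m) (c n) * nrm (d m)"
      by (intro form_diff_left v w)
    also have "\<dots> \<le> gap (c m) (c n) * M'"
      using N''[of m] that gap_nonneg[OF v v] by (intro mult_left_mono) auto
    also have "\<dots> < e / (2 * M') * M'"
      using N[of m n] that M' by (intro mult_strict_right_mono) auto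
    finally have 1: "cmod (form (c m) (d m) - form (c n) (d m)) < e / 2"
      using M' by simp
    have "cmod (form (c n) (d m) - form (c n) (d n)) \<le> nrm (c n) * gap (d m) (d n)"
      by (intro form_diff_right v w)
    also have "\<dots> \<le> M * gap (d m) (d n)"
      using N''[of n] that gap_nonneg[OF w w] by (intro mult_right_mono) auto
    also have "\<dots> < M * (e / (2 * M))"
      using N'[of m n] that M by (intro mult_strict_left_mono) auto
    finally have 2: "cmod (form (c n) (d m) - form (c n) (d n)) < e / 2"
      using M by simp
    show ?thesis
      using norm_triangle_ineq[of "form (c m) (d m) - form (c n) (d m)"
          "form (c n) (d m) - form (c n) (d n)"] 1 2 by simp
  qed
  then show "\<exists>N. \<forall>m\<ge>N. \<forall>n\<ge>N. norm (form (c m) (d m) - form (c n) (d n)) < e" by blast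
qed

lemma form_limit_unique_left:
  assumes "approx f c" "approx f c'" "approx g d"
  shows "(\<lambda>n. form (c n) (d n) - form (c' n) (d n)) \<longlonglongrightarrow> 0"
proof -
  note v = approxD(1)[OF assms(1)] approxD(1)[OF assms(2)] approxD(1)[OF assms(3)]
  have "approx (\<lambda>i s. \<zero>) (\<lambda>n. c n @ scale (- 1) (c' n))"
    using approx_diff[OF assms(1,2)] approxD(2)[OF assms(1)] by (simp add: M.minus_eq M.r_neg)
  then have gap: "(\<lambda>n. gap (c n) (c' n)) \<longlonglongrightarrow> 0"
    unfolding gap_def by (rule nrm_tendsto_zero)
  obtain M where M: "M > 0" "\<forall>\<^sub>F n in sequentially. nrm (d n) \<le> M"
    using Cauchy_combs_bounded[OF approxD(4)[OF assms(3)]] by blast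
  show ?thesis
  proof (rule Lim_null_comparison)
    show "(\<lambda>n. gap (c n) (c' n) * M) \<longlonglongrightarrow> 0"
      using tendsto_mult_left_zero[OF gap] .
    show "\<forall>\<^sub>F n in sequentially. norm (form (c n) (d n) - form (c' n) (d n)) \<le> gap (c n) (c' n) * M"
      using M(2)
    proof eventually_elim
      case (elim n)
      have "norm (form (c n) (d n) - form (c' n) (d n)) \<le> gap (c n) (c' n) * nrm (d n)"
        by (intro form_diff_left v)
      also have "\<dots> \<le> gap (c n) (c' n) * M"
        using elim gap_nonneg v by (intro mult_left_mono) auto
      finally show ?case .
    qed
  qed
qed

text \<open>
  By \<open>inner_limit\<close> below, every choice of approximating sequences yields the same value.
\<close>

definition inner :: "('p \<Rightarrow> 'q \<Rightarrow> 'a) \<Rightarrow> ('p \<Rightarrow> 'q \<Rightarrow> 'a) \<Rightarrow> complex"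
  where "inner f g = lim (\<lambda>n. form ((SOME c. approx f c) n) ((SOME d. approx g d) n))"

lemma inner_limit:
  assumes f: "approx f c" and g: "approx g d"
  shows "(\<lambda>n. form (c n) (d n)) \<longlonglongrightarrow> inner f g"
proof -
  define c' where "c' = (SOME c. approx f c)"
  define d' where "d' = (SOME d. approx g d)"
  have c': "approx f c'" unfolding c'_def by (rule someI[of _ c]) (rule f)
  have d': "approx g d'" unfolding d'_def by (rule someI[of _ d]) (rule g)
  have "(\<lambda>n. form (c' n) (d' n)) \<longlonglongrightarrow> inner f g"
    using form_convergent[OF c' d'] by (simp add: inner_def convergent_LIMSEQ_iff c'_def d'_def)
  moreover have "(\<lambda>n. form (c n) (d n) - form (c' n) (d n)) \<longlonglongrightarrow> 0"
    by (rule form_limit_unique_left[OF f c' g])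
  moreover have "(\<lambda>n. form (c' n) (d n) - form (c' n) (d' n)) \<longlonglongrightarrow> 0"
  proof -
    have "(\<lambda>n. cnj (form (d n) (c' n) - form (d' n) (c' n))) \<longlonglongrightarrow> cnj 0"
      by (intro tendsto_cnj form_limit_unique_left[OF g d' c'])
    moreover have "cnj (form (d n) (c' n) - form (d' n) (c' n)) = form (c' n) (d n) - form (c' n) (d' n)" for n
      using form_commute[of "c' n"] approxD(1)[OF g] approxD(1)[OF c'] approxD(1)[OF d'] by simp
    ultimately show ?thesis by simp
  qed
  ultimately have "(\<lambda>n. form (c' n) (d' n) + (form (c n) (d n) - form (c' n) (d n))
      + (form (c' n) (d n) - form (c' n) (d' n))) \<longlonglongrightarrow> inner f g + 0 + 0"
    by (intro tendsto_add)
  then show ?thesis by simp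
qed

definition rkhs :: "('p \<Rightarrow> 'q \<Rightarrow> 'a) cinner_space"
  where "rkhs = \<lparr>carrier = {f. \<exists>c. approx f c}, mult = (\<lambda>f g. f), one = (\<lambda>i s. \<zero>),
    zero = (\<lambda>i s. \<zero>), add = (\<lambda>f g i s. f i s \<oplus> g i s), smult = (\<lambda>a f i s. a \<odot> f i s),
    cinner = inner\<rparr>"

lemma rkhs_simps [simp]:
  "\<zero>\<^bsub>rkhs\<^esub> = (\<lambda>i s. \<zero>)"
  "f \<oplus>\<^bsub>rkhs\<^esub> g = (\<lambda>i s. f i s \<oplus> g i s)"
  "a \<odot>\<^bsub>rkhs\<^esub> f = (\<lambda>i s. a \<odot> f i s)"
  "cinner rkhs = inner"
  by (simp_all add: rkhs_def)

lemma rkhs_carrierI: "approx f c \<Longrightarrow> f \<in> carrier rkhs"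
  by (auto simp: rkhs_def)

lemma rkhs_carrierE:
  assumes "f \<in> carrier rkhs"
  obtains c where "approx f c"
  using assms by (auto simp: rkhs_def)

lemma rkhs_closed [simp]: "f \<in> carrier rkhs \<Longrightarrow> f i s \<in> carrier H"
  by (metis approxD(2) rkhs_carrierE)

lemma rkhs_add_closed:
  assumes "f \<in> carrier rkhs" "g \<in> carrier rkhs"
  shows "(\<lambda>i s. f i s \<oplus> g i s) \<in> carrier rkhs"
proof -
  obtain c d where "approx f c" "approx g d"
    using assms by (metis rkhs_carrierE)
  then show ?thesis by (rule rkhs_carrierI[OF approx_add])
qed

lemma rkhs_smult_closed:
  assumes "f \<in> carrier rkhs"
  shows "(\<lambda>i s. a \<odot> f i s) \<in> carrier rkhs"
proof -
  obtain c where "approx f c"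
    using assms by (rule rkhs_carrierE)
  then show ?thesis by (rule rkhs_carrierI[OF approx_smult])
qed

lemma inner_add_left:
  assumes f: "f \<in> carrier rkhs" and g: "g \<in> carrier rkhs" and h: "h \<in> carrier rkhs"
  shows "inner (\<lambda>i s. f i s \<oplus> g i s) h = inner f h + inner g h"
proof -
  obtain c d e where "approx f c" "approx g d" "approx h e"
    using f g h by (metis rkhs_carrierE)
  then have "(\<lambda>n. form (c n @ d n) (e n)) \<longlonglongrightarrow> inner (\<lambda>i s. f i s \<oplus> g i s) h"
    and "(\<lambda>n. form (c n) (e n) + form (d n) (e n)) \<longlonglongrightarrow> inner f h + inner g h"
    by (auto intro!: tendsto_add inner_limit approx_add)
  then show ?thesis
    by (simp add: form_append LIMSEQ_unique)
qed

lemma inner_smult_left: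
  assumes f: "f \<in> carrier rkhs" and h: "h \<in> carrier rkhs"
  shows "inner (\<lambda>i s. a \<odot> f i s) h = a * inner f h"
proof -
  obtain c e where ce: "approx f c" "approx h e"
    using f h by (metis rkhs_carrierE)
  then have "(\<lambda>n. form (scale a (c n)) (e n)) \<longlonglongrightarrow> inner (\<lambda>i s. a \<odot> f i s) h"
    and "(\<lambda>n. a * form (c n) (e n)) \<longlonglongrightarrow> a * inner f h"
    by (auto intro!: tendsto_mult inner_limit approx_smult)
  then show ?thesis
    using approxD(1)[OF ce(1)] approxD(1)[OF ce(2)] by (simp add: form_simps LIMSEQ_unique)
qed

lemma inner_commute:
  assumes f: "f \<in> carrier rkhs" and g: "g \<in> carrier rkhs"
  shows "inner f g = cnj (inner g f)"
proof -
  obtain c d where cd: "approx f c" "approx g d"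
    using f g by (metis rkhs_carrierE)
  then have "(\<lambda>n. form (c n) (d n)) \<longlonglongrightarrow> inner f g"
    and "(\<lambda>n. cnj (form (d n) (c n))) \<longlonglongrightarrow> cnj (inner g f)"
    by (auto intro!: tendsto_cnj inner_limit)
  moreover have "form (c n) (d n) = cnj (form (d n) (c n))" for n
    by (intro form_commute approxD(1)[OF cd(1)] approxD(1)[OF cd(2)])
  ultimately show ?thesis
    by (metis (no_types, lifting) LIMSEQ_unique ext)
qed

lemma inner_self_limit:
  assumes f: "approx f c"
  shows "(\<lambda>n. nrm (c n)) \<longlonglongrightarrow> sqrt (Re (inner f f))"
  unfolding nrm_def by (intro tendsto_real_sqrt tendsto_Re inner_limit f)

lemma inner_nonneg:
  assumes f: "f \<in> carrier rkhs"
  shows "0 \<le> Re (inner f f)"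
proof -
  obtain c where c: "approx f c"
    using f by (rule rkhs_carrierE)
  show ?thesis
    by (rule LIMSEQ_le_const[OF tendsto_Re[OF inner_limit[OF c c]]])
      (use form_nonneg approxD(1)[OF c] in auto)
qed

lemma inner_eq_zeroD:
  assumes f: "f \<in> carrier rkhs" and 0: "inner f f = 0"
  shows "f = (\<lambda>i s. \<zero>)"
proof (intro ext)
  fix i s
  obtain c where c: "approx f c"
    using f by (rule rkhs_carrierE)
  have nrm: "(\<lambda>n. nrm (c n)) \<longlonglongrightarrow> 0"
    using inner_self_limit[OF c] 0 by simp
  show "f i s = \<zero>"
  proof (rule vector_eqI)
    fix y assume y: "y \<in> carrier H"
    have "(\<lambda>n. cinner H (comb (c n) i s) y) \<longlonglongrightarrow> 0"
    proof (rule Lim_null_comparison)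
      show "(\<lambda>n. nrm (c n) * nrm [(i, s, y)]) \<longlonglongrightarrow> 0"
        using tendsto_mult_left_zero[OF nrm] .
      show "\<forall>\<^sub>F n in sequentially. norm (cinner H (comb (c n) i s) y) \<le> nrm (c n) * nrm [(i, s, y)]"
        using form_Cauchy_Schwarz[of "c _" "[(i, s, y)]"] approxD(1)[OF c] y
        by (intro always_eventually) (simp add: form_single_right)
    qed
    then show "cinner H (f i s) y = cinner H \<zero> y"
      using approxD(3)[OF c y, of i s] y by (simp add: cinner_simps LIMSEQ_unique)
  qed (use f in auto)
qed

sublocale rkhs: complex_inner_space rkhs
proof (intro complex_inner_space.intro complex_inner_space_axioms.intro moduleI abelian_groupI)
  show "cring complex_ring"
    using field_complex_ring by (intro domain.axioms(1) field.axioms(1))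
  fix f g h assume f: "f \<in> carrier rkhs" and g: "g \<in> carrier rkhs"
  show "f \<oplus>\<^bsub>rkhs\<^esub> g \<in> carrier rkhs"
    using f g by (simp add: rkhs_add_closed)
  show "f \<oplus>\<^bsub>rkhs\<^esub> g = g \<oplus>\<^bsub>rkhs\<^esub> f"
    using f g by (simp add: M.a_comm)
  assume h: "h \<in> carrier rkhs"
  show "f \<oplus>\<^bsub>rkhs\<^esub> g \<oplus>\<^bsub>rkhs\<^esub> h = f \<oplus>\<^bsub>rkhs\<^esub> (g \<oplus>\<^bsub>rkhs\<^esub> h)"
    using f g h by (simp add: M.a_assoc)
next
  show "\<zero>\<^bsub>rkhs\<^esub> \<in> carrier rkhs"
    using approx_zero by (auto intro: rkhs_carrierI)
next
  fix f assume f: "f \<in> carrier rkhs"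
  then show "\<zero>\<^bsub>rkhs\<^esub> \<oplus>\<^bsub>rkhs\<^esub> f = f" by simp
  have "(- 1) \<odot>\<^bsub>rkhs\<^esub> f \<in> carrier rkhs"
    using f by (simp add: rkhs_smult_closed)
  moreover have "(- 1) \<odot>\<^bsub>rkhs\<^esub> f \<oplus>\<^bsub>rkhs\<^esub> f = \<zero>\<^bsub>rkhs\<^esub>"
    using f by (auto intro!: ext vector_eqI simp: cinner_simps)
  ultimately show "\<exists>g\<in>carrier rkhs. g \<oplus>\<^bsub>rkhs\<^esub> f = \<zero>\<^bsub>rkhs\<^esub>"
    by blast
qed (auto simp: inner_add_left inner_smult_left inner_nonneg
    smult_laws smult_r_distr
    rkhs_smult_closed intro: inner_commute inner_eq_zeroD)

lemma rkhs_minus: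
  assumes "f \<in> carrier rkhs" "g \<in> carrier rkhs"
  shows "f \<ominus>\<^bsub>rkhs\<^esub> g = (\<lambda>i s. f i s \<ominus> g i s)"
proof -
  have "(- 1) \<odot>\<^bsub>rkhs\<^esub> g \<oplus>\<^bsub>rkhs\<^esub> g = \<zero>\<^bsub>rkhs\<^esub>"
    using assms by (auto intro!: ext vector_eqI simp: cinner_simps)
  then have "\<ominus>\<^bsub>rkhs\<^esub> g = (- 1) \<odot>\<^bsub>rkhs\<^esub> g"
    using assms rkhs.smult_in_carrier[of g "- 1"] by (intro rkhs.M.minus_equality) auto
  then show ?thesis
    using assms by (auto intro!: ext vector_eqI simp: rkhs.M.minus_eq cinner_simps)
qed

lemma comb_in_rkhs [simp, intro]: "valid l \<Longrightarrow> comb l \<in> carrier rkhs"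
  by (rule rkhs_carrierI[OF approx_comb])

lemma inner_comb: "valid l \<Longrightarrow> valid m \<Longrightarrow> inner (comb l) (comb m) = form l m"
  using inner_limit[OF approx_comb approx_comb, of l m] by (simp add: LIMSEQ_const_iff)

lemma reproducing:
  assumes f: "f \<in> carrier rkhs" and y: "y \<in> carrier H"
  shows "inner f (comb [(i, s, y)]) = cinner H (f i s) y"
proof -
  obtain c where c: "approx f c"
    using f by (rule rkhs_carrierE)
  have "(\<lambda>n. form (c n) [(i, s, y)]) \<longlonglongrightarrow> inner f (comb [(i, s, y)])"
    using c y by (intro inner_limit approx_comb) auto
  moreover have "(\<lambda>n. form (c n) [(i, s, y)]) \<longlonglongrightarrow> cinner H (f i s) y"
    using approxD(1)[OF c] approxD(3)[OF c y] y by (simp add: form_single_right)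
  ultimately show ?thesis by (rule LIMSEQ_unique)
qed

lemma cnorm_rkhs_limit: "approx f c \<Longrightarrow> (\<lambda>n. nrm (c n)) \<longlonglongrightarrow> cnorm rkhs f"
  using inner_self_limit by (simp add: cnorm_def)

lemma cnorm_comb_diff:
  assumes "valid l" "valid m"
  shows "cnorm rkhs (comb l \<ominus>\<^bsub>rkhs\<^esub> comb m) = gap l m"
  using cnorm_rkhs_limit[OF approx_diff[OF approx_comb approx_comb]] assms
  by (simp add: rkhs_minus LIMSEQ_const_iff gap_def)

lemma approx_converges:
  assumes f: "approx f c"
  shows "(\<lambda>n. cnorm rkhs (f \<ominus>\<^bsub>rkhs\<^esub> comb (c n))) \<longlonglongrightarrow> 0"
proof (rule LIMSEQ_I)
  note v = approxD(1)[OF f]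
  fix e :: real assume "e > 0"
  then have e: "e / 2 > 0" by simp
  obtain N where N: "\<And>m n. m \<ge> N \<Longrightarrow> n \<ge> N \<Longrightarrow> gap (c m) (c n) < e / 2"
    using Cauchy_combsD[OF approxD(4)[OF f] e] by blast
  have "norm (cnorm rkhs (f \<ominus>\<^bsub>rkhs\<^esub> comb (c n)) - 0) < e" if "n \<ge> N" for n
  proof -
    have "(\<lambda>m. gap (c m) (c n)) \<longlonglongrightarrow> cnorm rkhs (f \<ominus>\<^bsub>rkhs\<^esub> comb (c n))"
      using cnorm_rkhs_limit[OF approx_diff[OF f approx_comb[OF v[of n]]]] f v
      by (simp add: rkhs_minus rkhs_carrierI gap_def)
    then have "cnorm rkhs (f \<ominus>\<^bsub>rkhs\<^esub> comb (c n)) \<le> e / 2"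
      using N that by (intro LIMSEQ_le_const2) (auto intro!: exI[of _ N] less_imp_le)
    then show ?thesis
      using \<open>e > 0\<close> rkhs.cnorm_nonneg[of "f \<ominus>\<^bsub>rkhs\<^esub> comb (c n)"] f v by (simp add: rkhs_carrierI)
  qed
  then show "\<exists>N. \<forall>n\<ge>N. norm (cnorm rkhs (f \<ominus>\<^bsub>rkhs\<^esub> comb (c n)) - 0) < e" by blast
qed

lemma comb_dense:
  assumes "f \<in> carrier rkhs" "e > 0"
  obtains l where "valid l" "cnorm rkhs (f \<ominus>\<^bsub>rkhs\<^esub> comb l) < e"
proof -
  obtain c where c: "approx f c"
    using assms(1) by (rule rkhs_carrierE)
  have "\<forall>\<^sub>F n in sequentially. cnorm rkhs (f \<ominus>\<^bsub>rkhs\<^esub> comb (c n)) < e"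
    using order_tendstoD(2)[OF approx_converges[OF c] assms(2)] .
  then show ?thesis
    using that approxD(1)[OF c] by (auto simp: eventually_sequentially)
qed

text \<open>A Cauchy sequence is replaced by a sequence of combinations that comes closer and closer to
  it; as point evaluations are contractive, that sequence converges pointwise in \<open>H\<close>, and the limit
  function is the limit in the norm.\<close>

theorem rkhs_complete: "complex_hilbert_space rkhs"
proof (intro complex_hilbert_space.intro complex_hilbert_space_axioms.intro rkhs.complex_inner_space_axioms)
  show "rkhs.mcomplete"
    unfolding rkhs.mcomplete_def
  proof (intro allI impI)
    fix \<sigma> assume \<sigma>: "rkhs.MCauchy \<sigma>"
    then have \<sigma>_in [simp]: "\<sigma> n \<in> carrier rkhs" for n
      by (auto simp: rkhs.MCauchy_def)
    have "\<exists>l. valid l \<and> cnorm rkhs (\<sigma> n \<ominus>\<^bsub>rkhs\<^esub> comb l) < 1 / (real n + 1)" for n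
      by (rule comb_dense[of "\<sigma> n" "1 / (real n + 1)"]) auto
    then obtain l where l: "\<And>n. valid (l n)"
      "\<And>n. cnorm rkhs (\<sigma> n \<ominus>\<^bsub>rkhs\<^esub> comb (l n)) < 1 / (real n + 1)"
      by metis
    have Cauchy: "\<exists>N. \<forall>m\<ge>N. \<forall>n\<ge>N. gap (l m) (l n) < e" if "e > 0" for e
    proof -
      have "e / 3 > 0" using that by simp
      then obtain N where N: "\<And>m n. m \<ge> N \<Longrightarrow> n \<ge> N \<Longrightarrow> cdist rkhs (\<sigma> m) (\<sigma> n) < e / 3"
        using \<sigma> unfolding rkhs.MCauchy_def by meson
      obtain N' where N': "1 / (real N' + 1) < e / 3"
        using reals_Archimedean[OF \<open>e / 3 > 0\<close>] by (auto simp: inverse_eq_divide add.commute)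
      have "gap (l m) (l n) < e" if "m \<ge> max N N'" "n \<ge> max N N'" for m n
      proof -
        have small: "cdist rkhs (\<sigma> k) (comb (l k)) < e / 3" if "k \<ge> N'" for k
        proof -
          have "1 / (real k + 1) \<le> 1 / (real N' + 1)"
            using that by (simp add: frac_le)
          then show ?thesis
            using l[of k] N' by (simp add: cdist_def)
        qed
        have "gap (l m) (l n) = cdist rkhs (comb (l m)) (comb (l n))"
          using l by (simp add: cdist_def cnorm_comb_diff)
        also have "\<dots> \<le> cdist rkhs (comb (l m)) (\<sigma> m) + cdist rkhs (\<sigma> m) (\<sigma> n)
            + cdist rkhs (\<sigma> n) (comb (l n))"
          using rkhs.triangle[of "comb (l m)" "\<sigma> m" "comb (l n)"]
            rkhs.triangle[of "\<sigma> m" "\<sigma> n" "comb (l n)"] l by simp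
        also have "cdist rkhs (comb (l m)) (\<sigma> m) = cdist rkhs (\<sigma> m) (comb (l m))"
          by (rule rkhs.commute)
        finally show ?thesis
          using small[of m] small[of n] N[of m n] that by simp
      qed
      then show ?thesis by blast
    qed
    have "\<exists>x\<in>carrier H. (\<lambda>n. cnorm H (comb (l n) i s \<ominus> x)) \<longlonglongrightarrow> 0" for i s
    proof (rule norm_Cauchy_converges)
      fix e :: real assume "e > 0"
      have "cnorm H (comb (l m) i s \<ominus> comb (l n) i s) \<le> gap (l m) (l n)" for m n
      proof -
        have "comb (l m) i s \<ominus> comb (l n) i s = comb (l m @ scale (- 1) (l n)) i s"
          using l by (intro vector_eqI) (auto simp: cinner_simps cinner_comb_append cinner_comb_scale)
        then show ?thesis
          using cnorm_comb_le[of "l m @ scale (- 1) (l n)"] l by (simp add: gap_def)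
      qed
      then show "\<exists>N. \<forall>m\<ge>N. \<forall>n\<ge>N. cnorm H (comb (l m) i s \<ominus> comb (l n) i s) < e"
        using Cauchy[OF \<open>e > 0\<close>] by (meson order_le_less_trans)
    qed (use l in auto)
    then obtain f where f: "\<And>i s. f i s \<in> carrier H"
      "\<And>i s. (\<lambda>n. cnorm H (comb (l n) i s \<ominus> f i s)) \<longlonglongrightarrow> 0"
      by metis
    have "approx f l"
      unfolding approx_def
    proof (intro conjI allI ballI)
      show "Cauchy_combs l"
        using Cauchy l by (simp add: Cauchy_combs_def)
      fix i s y assume y: "y \<in> carrier H"
      have "(\<lambda>n. cinner H (comb (l n) i s) y - cinner H (f i s) y) \<longlonglongrightarrow> 0"
      proof (rule Lim_null_comparison)
        show "(\<lambda>n. cnorm H (comb (l n) i s \<ominus> f i s) * cnorm H y) \<longlonglongrightarrow> 0"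
          using tendsto_mult_left_zero[OF f(2)] .
        show "\<forall>\<^sub>F n in sequentially. norm (cinner H (comb (l n) i s) y - cinner H (f i s) y)
            \<le> cnorm H (comb (l n) i s \<ominus> f i s) * cnorm H y"
          using Cauchy_Schwarz[where y = y] f(1) l y
          by (intro always_eventually) (simp flip: cinner_diff_left)
      qed
      then show "(\<lambda>n. cinner H (comb (l n) i s) y) \<longlonglongrightarrow> cinner H (f i s) y"
        by (simp add: LIM_zero_iff)
    qed (rule f)
    then have f_in: "f \<in> carrier rkhs" and lf: "(\<lambda>n. cnorm rkhs (f \<ominus>\<^bsub>rkhs\<^esub> comb (l n))) \<longlonglongrightarrow> 0"
      by (auto intro: rkhs_carrierI approx_converges)
    have "(\<lambda>n. cdist rkhs (\<sigma> n) f) \<longlonglongrightarrow> 0"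
    proof (rule Lim_null_comparison)
      have "(\<lambda>n. 1 / (real n + 1)) \<longlonglongrightarrow> 0"
        using LIMSEQ_inverse_real_of_nat by (simp add: inverse_eq_divide add.commute)
      from tendsto_add[OF this lf]
      show "(\<lambda>n. 1 / (real n + 1) + cnorm rkhs (f \<ominus>\<^bsub>rkhs\<^esub> comb (l n))) \<longlonglongrightarrow> 0"
        by simp
      have "cdist rkhs (\<sigma> n) f \<le> 1 / (real n + 1) + cnorm rkhs (f \<ominus>\<^bsub>rkhs\<^esub> comb (l n))" for n
        using rkhs.triangle[of "\<sigma> n" "comb (l n)" f] l[of n] f_in rkhs.commute[of "comb (l n)" f]
        by (simp add: cdist_def)
      then show "\<forall>\<^sub>F n in sequentially. norm (cdist rkhs (\<sigma> n) f)
          \<le> 1 / (real n + 1) + cnorm rkhs (f \<ominus>\<^bsub>rkhs\<^esub> comb (l n))"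
        by simp
    qed
    then have "limitin rkhs.mtopology \<sigma> f sequentially"
      using f_in by (simp add: rkhs.limitin_metric_dist_null)
    then show "\<exists>f. limitin rkhs.mtopology \<sigma> f sequentially" by blast
  qed
qed

end


section \<open>Positivity of the glued kernel\<close>

lemma sum_list_map_mset_cong:
  fixes f :: "'x \<Rightarrow> 'b::comm_monoid_add"
  shows "mset l = mset m \<Longrightarrow> (\<Sum>a\<leftarrow>l. f a) = (\<Sum>a\<leftarrow>m. f a)"
  by (simp flip: sum_mset_sum_list)

lemma sum_list_diagonal_blocks:
  fixes g :: "'x \<Rightarrow> 'x \<Rightarrow> 'b::comm_monoid_add"
  shows "(\<Sum>a\<leftarrow>l. \<Sum>b\<leftarrow>l. if key a = key b then g a b else 0) =
    (\<Sum>i\<in>key ` set l. \<Sum>a\<leftarrow>filter (\<lambda>a. key a = i) l. \<Sum>b\<leftarrow>filter (\<lambda>b. key b = i) l. g a b)"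
proof -
  have outer: "(\<Sum>a\<leftarrow>m. h (key a) a) = (\<Sum>i\<in>J. \<Sum>a\<leftarrow>filter (\<lambda>a. key a = i) m. h i a)"
    if "finite J" "key ` set m \<subseteq> J" for h :: "_ \<Rightarrow> _ \<Rightarrow> 'b" and J m
    using that(2)
  proof (induction m)
    case (Cons a m)
    have "(\<Sum>i\<in>J. \<Sum>a\<leftarrow>filter (\<lambda>a. key a = i) (a # m). h i a) =
        (\<Sum>i\<in>J. (if i = key a then h i a else 0) + (\<Sum>a\<leftarrow>filter (\<lambda>a. key a = i) m. h i a))"
      by (intro sum.cong) auto
    also have "\<dots> = h (key a) a + (\<Sum>i\<in>J. \<Sum>a\<leftarrow>filter (\<lambda>a. key a = i) m. h i a)"
      using that Cons by (simp add: sum.distrib)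
    finally show ?case using Cons by simp
  qed simp
  have inner: "(\<Sum>b\<leftarrow>l. if k = key b then g a b else 0) = (\<Sum>b\<leftarrow>filter (\<lambda>b. key b = k) l. g a b)"
    for a k
    by (simp add: sum_list_map_filter' eq_commute)
  show ?thesis
    unfolding inner by (rule outer) auto
qed

locale contractive_family = complex_hilbert_space H
  for H :: "('a, 'm) cinner_space_scheme" (structure) +
  fixes T :: "'i \<Rightarrow> real \<Rightarrow> 'a \<Rightarrow> 'a"
  assumes semigroup: "contractive_C0_semigroup H (T i)"
begin

text \<open>
  This is \<open>r\<^sup>* U(t - s) r\<close> for a unitary dilation \<open>U\<close> of \<open>T i\<close>.
\<close>

definition kern :: "'i \<Rightarrow> real \<Rightarrow> real \<Rightarrow> 'a \<Rightarrow> 'a"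
  where "kern i s t x = (if s \<le> t then T i (t - s) x else adjoint_op H H (T i (s - t)) x)"

text \<open>
  The subspaces of two different indices meet along \<open>H\<close> only and are orthogonal apart from that, so an
  inner product between them is computed after projecting to \<open>H\<close>, that is, via time 0.
\<close>

definition glued :: "'i \<Rightarrow> real \<Rightarrow> 'i \<Rightarrow> real \<Rightarrow> 'a \<Rightarrow> 'a"
  where "glued i s j t x = (if i = j then kern i s t x else kern i s 0 (kern j 0 t x))"

text \<open>
  The hypothesis restricts rewriting to applied occurrences of \<open>glued\<close>; the bare constant is a parameter
  of \<open>comb\<close>, \<open>form\<close> and \<open>rkhs\<close>.
\<close>

lemma glued_eq: "x \<in> carrier H \<Longrightarrow>
    glued i s j t x = (if i = j then kern i s t x else kern i s 0 (kern j 0 t x))"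
  by (simp add: glued_def)

lemma T_contraction: "0 \<le> t \<Longrightarrow> contraction H (T i t)"
  using semigroup[of i] by (simp add: contractive_C0_semigroup_def)

lemma T_closed [simp, intro]: "0 \<le> t \<Longrightarrow> x \<in> carrier H \<Longrightarrow> T i t x \<in> carrier H"
  using T_contraction[of t i] by (auto simp: contraction_def linear_operator_def)

lemma T_plus: "0 \<le> t \<Longrightarrow> x \<in> carrier H \<Longrightarrow> y \<in> carrier H \<Longrightarrow> T i t (x \<oplus> y) = T i t x \<oplus> T i t y"
  using T_contraction[of t i] by (auto simp: contraction_def linear_operator_def)

lemma cnorm_T: "0 \<le> t \<Longrightarrow> x \<in> carrier H \<Longrightarrow> cnorm H (T i t x) \<le> cnorm H x"
  using T_contraction[of t i] by (auto simp: contraction_def)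

lemma T_zero [simp]: "x \<in> carrier H \<Longrightarrow> T i 0 x = x"
  using semigroup[of i] by (simp add: contractive_C0_semigroup_def)

lemma T_add: "0 \<le> s \<Longrightarrow> 0 \<le> t \<Longrightarrow> x \<in> carrier H \<Longrightarrow> T i (s + t) x = T i s (T i t x)"
  using semigroup[of i] by (simp add: contractive_C0_semigroup_def)

lemma kern_le: "s \<le> t \<Longrightarrow> kern i s t x = T i (t - s) x"
  by (simp add: kern_def)

lemma kern_closed [simp, intro]: "x \<in> carrier H \<Longrightarrow> kern i s t x \<in> carrier H"
  by (simp add: kern_def T_contraction contraction_adjoint)

lemma kern_self [simp]: "x \<in> carrier H \<Longrightarrow> kern i s s x = x"
  by (simp add: kern_def)

lemma kern_shift: "kern i (s + h) (t + h) x = kern i s t x"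
  by (simp add: kern_def)

lemma kern_adjoint:
  assumes "x \<in> carrier H" "y \<in> carrier H"
  shows "cinner H (kern i s t x) y = cinner H x (kern i t s y)"
proof -
  consider "s < t" | "s = t" | "s > t" by linarith
  then show ?thesis
  proof cases
    case 1
    then show ?thesis
      using assms contraction_adjoint(2)[OF T_contraction, of "t - s" y x i] by (simp add: kern_def)
  next
    case 3
    then have "cinner H (T i (s - t) y) x = cinner H y (kern i s t x)"
      using assms contraction_adjoint(2)[OF T_contraction, of "s - t" x y i] by (simp add: kern_def)
    then show ?thesis
      using 3 assms kern_closed[of x i s t] cinner_commute[of "kern i s t x" y] cinner_commute[of x "T i (s - t) y"]
      by (simp add: kern_def)
  qed (use assms in simp)
qed

lemma kern_linear:
  assumes "x \<in> carrier H" "y \<in> carrier H"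
  shows "kern i s t (x \<oplus> y) = kern i s t x \<oplus> kern i s t y"
    and "kern i s t (x \<ominus> y) = kern i s t x \<ominus> kern i s t y"
    and "kern i s t (\<ominus> x) = \<ominus> kern i s t x"
    and "kern i s t (c \<odot> x) = c \<odot> kern i s t x"
  using assms by (auto intro!: vector_eqI simp: kern_adjoint cinner_simps)

definition kform :: "'i \<Rightarrow> (real \<times> 'a) list \<Rightarrow> (real \<times> 'a) list \<Rightarrow> complex"
  where "kform i l m = (\<Sum>(t, x)\<leftarrow>l. \<Sum>(s, y)\<leftarrow>m. cinner H (kern i s t x) y)"

lemma kform_Cons:
  fixes i s
  assumes "x \<in> carrier H" "\<forall>(t, y)\<in>set l. y \<in> carrier H"
  defines "v \<equiv> vsum (\<lambda>(t, y). kern i s t y) l"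
  shows "kform i ((s, x) # l) ((s, x) # l) = cinner H x x + cinner H x v + cinner H v x + kform i l l"
proof -
  have "(\<Sum>(t, y)\<leftarrow>l. cinner H (kern i t s x) y) = cinner H x v"
    using assms by (subst v_def, subst cinner_vsum_right)
      (auto intro!: arg_cong[of _ _ sum_list] map_cong simp: kern_adjoint)
  moreover have "(\<Sum>(t, y)\<leftarrow>l. cinner H (kern i s t y) x) = cinner H v x"
    using assms by (subst v_def, subst cinner_vsum_left)
      (auto intro!: arg_cong[of _ _ sum_list] map_cong)
  ultimately show ?thesis
    using assms(1) by (simp add: kform_def case_prod_unfold sum_list_addf)
qed

text \<open>
  Let \<open>s\<close> be the first time, \<open>x\<close> its vector and \<open>v\<close> the sum of the \<open>T (t - s) y\<close> over the later entries
  \<open>(t, y)\<close>. The cross terms of \<open>x\<close> in the quadratic form are those of \<open>\<parallel>x + v\<parallel>\<^sup>2\<close>, so the form is the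
  form of the later entries plus \<open>\<parallel>x + v\<parallel>\<^sup>2 - \<parallel>v\<parallel>\<^sup>2\<close>. By induction the former is at least \<open>\<parallel>v\<parallel>\<^sup>2\<close>, and
  \<open>\<parallel>x + v\<parallel>\<close> bounds \<open>\<parallel>T (s - a) (x + v)\<parallel>\<close> because \<open>T\<close> is contractive.
\<close>

lemma kform_sorted:
  assumes "sorted (map fst l)" "\<forall>(t, x)\<in>set l. x \<in> carrier H" "\<forall>(t, x)\<in>set l. a \<le> t"
  shows "(cnorm H (vsum (\<lambda>(t, x). kern i a t x) l))\<^sup>2 \<le> Re (kform i l l)"
  using assms
proof (induction l arbitrary: a)
  case Nil
  then show ?case by (simp add: kform_def cnorm_def cinner_simps)
next
  case (Cons b l)
  obtain s x where b: "b = (s, x)" by (cases b)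
  have x: "x \<in> carrier H" and l: "\<forall>(t, x)\<in>set l. x \<in> carrier H" and as: "a \<le> s"
    and sl: "\<forall>(t, x)\<in>set l. s \<le> t"
    using Cons.prems by (auto simp: b)
  define v where "v = vsum (\<lambda>(t, x). kern i s t x) l"
  have v: "v \<in> carrier H"
    unfolding v_def using l by (intro vsum_closed) auto
  have "vsum (\<lambda>(t, x). kern i a t x) m = T i (s - a) (vsum (\<lambda>(t, x). kern i s t x) m)"
    if "\<forall>(t, x)\<in>set m. x \<in> carrier H \<and> s \<le> t" for m
    using that
  proof (induction m)
    case Nil
    have "kern i a s \<zero> = \<zero>"
      by (auto intro!: vector_eqI simp: kern_adjoint cinner_simps)
    then show ?case using as by (simp add: kern_le)
  next
    case (Cons b m)
    obtain t y where b: "b = (t, y)" by (cases b)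
    have "T i (t - a) y = T i (s - a) (T i (t - s) y)"
      using T_add[of "s - a" "t - s" y i] Cons.prems as by (simp add: b)
    moreover have "vsum (\<lambda>(t, x). kern i s t x) m \<in> carrier H"
      using Cons.prems by (intro vsum_closed) auto
    ultimately show ?case
      using Cons as by (simp add: b T_plus kern_le)
  qed
  moreover have lm: "\<forall>(t, x)\<in>set l. x \<in> carrier H \<and> s \<le> t"
    using l sl by auto
  ultimately have "vsum (\<lambda>(t, x). kern i a t x) (b # l) = T i (s - a) (x \<oplus> v)"
    using as x v lm by (simp add: b v_def T_plus kern_le)
  then have "(cnorm H (vsum (\<lambda>(t, x). kern i a t x) (b # l)))\<^sup>2 \<le> (cnorm H (x \<oplus> v))\<^sup>2"
    using as x v by (auto intro!: power_mono cnorm_T cnorm_nonneg)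
  also have "\<dots> = Re (cinner H x x + cinner H x v + cinner H v x) + (cnorm H v)\<^sup>2"
    using x v by (simp add: cnorm_power2 cinner_simps)
  also have "\<dots> \<le> Re (cinner H x x + cinner H x v + cinner H v x) + Re (kform i l l)"
    unfolding v_def using Cons.IH[of s] Cons.prems l sl by simp
  also have "\<dots> = Re (kform i (b # l) (b # l))"
    using kform_Cons[OF x l, of i s] by (simp add: b v_def)
  finally show ?case .
qed

lemma kform_nonneg:
  assumes "\<forall>(t, x)\<in>set l. x \<in> carrier H"
  shows "0 \<le> Re (kform i l l)"
proof -
  define m where "m = sort_key fst l"
  have m: "mset m = mset l" "set m = set l" "sorted (map fst m)"
    by (simp_all add: m_def)
  have "kform i l l = kform i m m"
    unfolding kform_def sum_list_map_mset_cong[OF m(1)] ..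
  moreover have "0 \<le> Re (kform i m m)"
  proof (cases m)
    case (Cons b m')
    then have "\<forall>(t, x)\<in>set m. fst b \<le> t"
      using m(3) by auto
    then have "(cnorm H (vsum (\<lambda>(t, x). kern i (fst b) t x) m))\<^sup>2 \<le> Re (kform i m m)"
      using m assms by (intro kform_sorted) auto
    then show ?thesis
      by (rule order_trans[OF zero_le_power2])
  qed (simp add: kform_def)
  ultimately show ?thesis by simp
qed

text \<open>
  Subtracting from a vector its projection \<open>v\<close> to \<open>H\<close> leaves a vector of nonnegative squared norm; in
  terms of the form, an entry \<open>- v\<close> at time 0 is added.
\<close>

lemma kform_ge_anchor:
  assumes "\<forall>(t, x)\<in>set l. x \<in> carrier H"
  shows "(cnorm H (vsum (\<lambda>(t, x). kern i 0 t x) l))\<^sup>2 \<le> Re (kform i l l)"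
proof -
  define v where "v = vsum (\<lambda>(t, x). kern i 0 t x) l"
  have v: "v \<in> carrier H"
    unfolding v_def using assms by (intro vsum_closed) auto
  have "0 \<le> Re (kform i ((0, \<ominus> v) # l) ((0, \<ominus> v) # l))"
    using assms v by (intro kform_nonneg) auto
  also have "\<dots> = Re (kform i l l) - (cnorm H v)\<^sup>2"
    using kform_Cons[of "\<ominus> v" l i 0] assms v by (simp add: cinner_simps cnorm_power2 flip: v_def)
  finally show ?thesis by (simp add: v_def)
qed

text \<open>
  The glued form splits orthogonally: the projection of the whole sum to \<open>H\<close>, and for each index the
  part of its own entries that is orthogonal to \<open>H\<close>, which \<open>kform_ge_anchor\<close> takes care of.
\<close>

lemma glued_positive:
  assumes l: "\<forall>(j, t, x)\<in>set l. x \<in> carrier H"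
  shows "0 \<le> Re (\<Sum>(j, t, x)\<leftarrow>l. \<Sum>(i, s, y)\<leftarrow>l. cinner H (glued i s j t x) y)"
proof -
  define c where "c = (\<lambda>(j, t, x). kern j 0 t x)"
  define g where "g = (\<lambda>(j, t, x) (i :: 'i, s, y). cinner H (kern j s t x) y)"
  have c: "c a \<in> carrier H" if "a \<in> set l" for a
    using that l by (auto simp: c_def split: prod.splits)
  have square: "Re (\<Sum>a\<leftarrow>m. \<Sum>b\<leftarrow>m. cinner H (c a) (c b)) = (cnorm H (vsum c m))\<^sup>2"
    if "set m \<subseteq> set l" for m
  proof -
    have "(\<Sum>a\<leftarrow>m. \<Sum>b\<leftarrow>m. cinner H (c a) (c b)) = (\<Sum>a\<leftarrow>m. cinner H (c a) (vsum c m))"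
      using that c by (intro arg_cong[of _ _ sum_list] map_cong refl)
        (auto intro!: cinner_vsum_right[symmetric])
    also have "\<dots> = cinner H (vsum c m) (vsum c m)"
      using that c by (auto intro!: cinner_vsum_left[symmetric] vsum_closed)
    finally show ?thesis
      using that c by (auto intro!: cnorm_power2[symmetric] vsum_closed)
  qed
  have "(\<Sum>(j, t, x)\<leftarrow>l. \<Sum>(i, s, y)\<leftarrow>l. cinner H (glued i s j t x) y) =
      (\<Sum>a\<leftarrow>l. \<Sum>b\<leftarrow>l. cinner H (c a) (c b) +
        (if fst a = fst b then g a b - cinner H (c a) (c b) else 0))"
  proof -
    have "x \<in> carrier H" if "(j, t, x) \<in> set l" for j t x
      using that l by auto
    then show ?thesis
      unfolding case_prod_unfold
      by (intro arg_cong[of _ _ sum_list] map_cong refl)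
        (auto simp: glued_def c_def g_def kern_adjoint)
  qed
  also have "\<dots> = (\<Sum>a\<leftarrow>l. \<Sum>b\<leftarrow>l. cinner H (c a) (c b)) +
      (\<Sum>a\<leftarrow>l. \<Sum>b\<leftarrow>l. if fst a = fst b then g a b - cinner H (c a) (c b) else 0)"
    by (simp add: sum_list_addf)
  also have "Re \<dots> = (cnorm H (vsum c l))\<^sup>2 +
      (\<Sum>i\<in>fst ` set l. Re (\<Sum>a\<leftarrow>filter (\<lambda>a. fst a = i) l. \<Sum>b\<leftarrow>filter (\<lambda>b. fst b = i) l.
        g a b - cinner H (c a) (c b)))"
    by (simp add: square sum_list_diagonal_blocks)
  also have "\<dots> \<ge> 0"
  proof (intro add_nonneg_nonneg sum_nonneg)
    fix i assume "i \<in> fst ` set l"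
    define m where "m = filter (\<lambda>a. fst a = i) l"
    have m: "\<forall>(t, x)\<in>set (map snd m). x \<in> carrier H"
      using l by (auto simp: m_def)
    have "(\<Sum>a\<leftarrow>m. \<Sum>b\<leftarrow>m. g a b) = kform i (map snd m) (map snd m)"
      unfolding kform_def map_map comp_def case_prod_unfold
      by (intro arg_cong[of _ _ sum_list] map_cong refl) (auto simp: g_def m_def)
    moreover have "vsum c m = vsum (\<lambda>(t, x). kern i 0 t x) (map snd m)"
    proof -
      have "vsum c m' = vsum (\<lambda>(t, x). kern i 0 t x) (map snd m')" if "\<forall>a\<in>set m'. fst a = i" for m'
        using that by (induction m') (auto simp: c_def)
      then show ?thesis by (simp add: m_def)
    qed
    ultimately show "0 \<le> Re (\<Sum>a\<leftarrow>filter (\<lambda>a. fst a = i) l. \<Sum>b\<leftarrow>filter (\<lambda>b. fst b = i) l.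
        g a b - cinner H (c a) (c b))"
      using kform_ge_anchor[OF m, of i] square[of m]
      by (simp add: sum_list_subtractf flip: m_def) (simp add: m_def)
  qed simp
  finally show ?thesis .
qed

sublocale operator_kernel H glued
proof
  fix x y i s j t assume x: "x \<in> carrier H"
  then show "glued i s j t x \<in> carrier H" "glued i s i s x = x"
    by (simp_all add: glued_def)
  assume y: "y \<in> carrier H"
  show "cinner H (glued i s j t x) y = cinner H x (glued j t i s y)"
    using x y by (simp add: glued_def kern_adjoint)
qed (rule glued_positive)

end


section \<open>The unitary groups\<close>

context contractive_family
begin

text \<open>
  If \<open>f\<close> represents \<open>v\<close>, then \<open>shift i h f\<close> represents \<open>U\<^sub>i(h) v\<close>. For \<open>j \<noteq> i\<close> the component of \<open>v\<close> in the
  complement of \<open>H\<close> that belongs to \<open>j\<close> is fixed, and only the component in \<open>H\<close> changes, from \<open>f i 0\<close>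
  to \<open>f i (- h)\<close>; an element \<open>z\<close> of \<open>H\<close> contributes \<open>kern j s 0 z\<close> to the value at \<open>(j, s)\<close>.
\<close>

definition shift :: "'i \<Rightarrow> real \<Rightarrow> ('i \<Rightarrow> real \<Rightarrow> 'a) \<Rightarrow> 'i \<Rightarrow> real \<Rightarrow> 'a"
  where "shift i h f j s =
    (if j = i then f i (s - h) else f j s \<oplus> kern j s 0 (f i (- h) \<ominus> f i 0))"

text \<open>
  The shift on formal combinations. A vector \<open>V\<^sub>j\<^sub>,\<^sub>t x\<close> with \<open>j \<noteq> i\<close> is \<open>(V\<^sub>j\<^sub>,\<^sub>t x - z) + z\<close>, where \<open>z\<close> is its
  projection to \<open>H\<close>; the first summand is fixed and \<open>z\<close> moves to \<open>V\<^sub>i\<^sub>,\<^sub>h z\<close>.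
\<close>

definition shift_list :: "'i \<Rightarrow> real \<Rightarrow> ('i \<times> real \<times> 'a) list \<Rightarrow> ('i \<times> real \<times> 'a) list"
  where "shift_list i h l = concat (map (\<lambda>(j, t, x).
    if j = i then [(i, t + h, x)]
    else [(j, t, x), (i, 0, \<ominus> kern j 0 t x), (i, h, kern j 0 t x)]) l)"

lemma shift_list_simps [simp]:
  "shift_list i h [] = []"
  "shift_list i h ((j, t, x) # l) =
    (if j = i then [(i, t + h, x)]
     else [(j, t, x), (i, 0, \<ominus> kern j 0 t x), (i, h, kern j 0 t x)]) @ shift_list i h l"
  by (simp_all add: shift_list_def)

lemma valid_shift_list [simp]: "valid l \<Longrightarrow> valid (shift_list i h l)"
  by (induction l) auto

lemma shift_closed:
  assumes "\<And>j s. f j s \<in> carrier H"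
  shows "shift i h f j s \<in> carrier H"
  using assms by (simp add: shift_def)

lemma cinner_shift:
  assumes "\<And>j s. f j s \<in> carrier H" "y \<in> carrier H"
  shows "cinner H (shift i h f j s) y = (if j = i then cinner H (f i (s - h)) y
    else cinner H (f j s) y + cinner H (f i (- h)) (kern j 0 s y) - cinner H (f i 0) (kern j 0 s y))"
  using assms by (simp add: shift_def cinner_simps kern_adjoint)

lemma comb_shift_list:
  assumes "valid l"
  shows "comb (shift_list i h l) = shift i h (comb l)"
proof (intro ext vector_eqI)
  fix k s y assume y: "y \<in> carrier H"
  show "cinner H (comb (shift_list i h l) k s) y = cinner H (shift i h (comb l) k s) y"
    using assms
  proof (induction l)
    case Nil
    then show ?case using y by (simp add: cinner_shift cinner_simps)
  next
    case (Cons a l)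
    obtain j t x where a: "a = (j, t, x)" by (cases a)
    have x: "x \<in> carrier H" and l: "valid l" using Cons.prems by (auto simp: a)
    have hs: "kern i s (t + h) x = kern i (s - h) t x" "kern i 0 (t + h) x = kern i (- h) t x"
      "kern i s h z = kern i (s - h) 0 z" "kern i 0 h z = kern i (- h) 0 z" for z
      using kern_shift[of i "s - h" h t x] kern_shift[of i "- h" h t x] kern_shift[of i "s - h" h 0 z]
        kern_shift[of i "- h" h 0 z] by simp_all
    have hs': "kern m (a + h) b z = kern m a (b - h) z" for m a b z
      using kern_shift[of m a h "b - h" z] by simp
    from hs'[of _ t 0] have "kern m (t + h) 0 z = kern m t (- h) z" for m z
      by simp
    note hs' = hs' this
    show ?case
      using Cons.IH[OF l] x l y
      by (simp add: a cinner_comb_append cinner_shift cinner_simps glued_eq kern_linear hs)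
        (auto simp: kern_adjoint hs')
  qed
qed (use assms shift_closed in auto)

text \<open>
  It suffices to test with a single kernel function at \<open>(j, s)\<close>. There the form is a value of the
  shifted function, by \<open>comb_shift_list\<close>: for \<open>j = i\<close> the two translations cancel, and for \<open>j \<noteq> i\<close>
  the two entries that were added compensate the correction term in \<open>shift\<close>.
\<close>

lemma form_shift_list:
  assumes "valid l" "valid m"
  shows "form (shift_list i h l) (shift_list i h m) = form l m"
  using assms(2)
proof (induction m)
  case (Cons b m)
  obtain j s y where b: "b = (j, s, y)" by (cases b)
  have y: "y \<in> carrier H" and m: "valid m" using Cons.prems by (auto simp: b)
  have "form (shift_list i h l) (shift_list i h [b]) = form l [b]"
    using assms(1) y
    by (simp add: b form_Cons_right[of _ _ "_ # _"] form_single_right comb_shift_list cinner_shift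
        cinner_simps)
  then show ?case
    using Cons.IH[OF m] form_append(2)[of "shift_list i h l" "shift_list i h [b]" "shift_list i h m"]
    by (simp add: b form_Cons_right[of l _ m])
qed simp

lemma approx_shift:
  assumes f: "approx f c"
  shows "approx (shift i h f) (\<lambda>n. shift_list i h (c n))"
proof -
  note v = approxD(1)[OF f]
  have "gap (shift_list i h (c m)) (shift_list i h (c n)) = gap (c m) (c n)" for m n
    using v by (simp add: gap_def nrm_def form_simps form_shift_list)
  then have "Cauchy_combs (\<lambda>n. shift_list i h (c n))"
    using approxD(4)[OF f] by (simp add: Cauchy_combs_def)
  moreover have "(\<lambda>n. cinner H (comb (shift_list i h (c n)) j s) y) \<longlonglongrightarrow> cinner H (shift i h f j s) y"
    if "y \<in> carrier H" for j s y
    using that v approxD(2)[OF f] by (auto simp: comb_shift_list cinner_shift intro!: tendsto_intros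
        approxD(3)[OF f])
  ultimately show ?thesis
    using approxD(2)[OF f] by (simp add: approx_def shift_closed)
qed

lemma shift_in_rkhs [simp, intro]:
  assumes "f \<in> carrier rkhs"
  shows "shift i h f \<in> carrier rkhs"
proof -
  obtain c where "approx f c"
    using assms by (rule rkhs_carrierE)
  then show ?thesis by (rule rkhs_carrierI[OF approx_shift])
qed

lemma inner_shift:
  assumes f: "f \<in> carrier rkhs" and g: "g \<in> carrier rkhs"
  shows "inner (shift i h f) (shift i h g) = inner f g"
proof -
  obtain c d where cd: "approx f c" "approx g d"
    using f g by (metis rkhs_carrierE)
  have "(\<lambda>n. form (shift_list i h (c n)) (shift_list i h (d n))) \<longlonglongrightarrow> inner (shift i h f) (shift i h g)"
    by (intro inner_limit approx_shift cd)
  then show ?thesis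
    using inner_limit[OF cd] approxD(1)[OF cd(1)] approxD(1)[OF cd(2)]
    by (simp add: form_shift_list LIMSEQ_unique)
qed

lemma shift_shift:
  assumes "\<And>j s. f j s \<in> carrier H"
  shows "shift i h (shift i h' f) = shift i (h + h') f"
proof (intro ext vector_eqI)
  fix j s y assume "y \<in> carrier H"
  then show "cinner H (shift i h (shift i h' f) j s) y = cinner H (shift i (h + h') f j s) y"
    using assms by (simp add: cinner_shift shift_closed) (simp add: shift_def diff_diff_eq add.commute)
qed (use assms shift_closed in auto)

lemma shift_0:
  assumes "\<And>j s. f j s \<in> carrier H"
  shows "shift i 0 f = f"
proof (intro ext vector_eqI)
  fix j s y assume "y \<in> carrier H"
  then show "cinner H (shift i 0 f j s) y = cinner H (f j s) y"
    using assms by (simp add: cinner_shift)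
qed (use assms shift_closed in auto)

lemma shift_linear:
  assumes "f \<in> carrier rkhs" "g \<in> carrier rkhs"
  shows "shift i h (f \<oplus>\<^bsub>rkhs\<^esub> g) = shift i h f \<oplus>\<^bsub>rkhs\<^esub> shift i h g"
    and "shift i h (f \<ominus>\<^bsub>rkhs\<^esub> g) = shift i h f \<ominus>\<^bsub>rkhs\<^esub> shift i h g"
    and "shift i h (a \<odot>\<^bsub>rkhs\<^esub> f) = a \<odot>\<^bsub>rkhs\<^esub> shift i h f"
  using assms
  by (auto intro!: ext vector_eqI simp: rkhs_minus cinner_shift cinner_simps shift_closed algebra_simps)

lemma unitary_shift: "unitary rkhs (shift i h)"
  unfolding unitary_def linear_operator_def
proof (intro conjI allI ballI)
  show "shift i h ` carrier rkhs = carrier rkhs"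
  proof
    show "carrier rkhs \<subseteq> shift i h ` carrier rkhs"
    proof
      fix f assume f: "f \<in> carrier rkhs"
      then have "f = shift i h (shift i (- h) f)"
        by (simp add: shift_shift shift_0)
      then show "f \<in> shift i h ` carrier rkhs"
        using f by blast
    qed
  qed auto
qed (simp_all add: shift_linear(1,3)[simplified] inner_shift)

lemma cnorm_shift: "f \<in> carrier rkhs \<Longrightarrow> cnorm rkhs (shift i h f) = cnorm rkhs f"
  by (simp add: cnorm_def inner_shift)


subsection \<open>Strong continuity\<close>

text \<open>
  The adjoint semigroup needs no continuity of its own: weakly, it is the given semigroup tested
  with the arguments exchanged.
\<close>

lemma kern_weakly_continuous:
  assumes x: "x \<in> carrier H" and y: "y \<in> carrier H"
  shows "continuous_on UNIV (\<lambda>s. cinner H (kern i s t x) y)"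
proof -
  have cont: "continuous_on {0..} (\<lambda>t. cinner H (T i t x) y)"
    if "x \<in> carrier H" "y \<in> carrier H" for x y
    using strongly_continuous_imp_weakly_continuous semigroup[of i] that
    by (auto simp: contractive_C0_semigroup_def)
  have "continuous_on {..t} (\<lambda>s. cinner H (T i (t - s) x) y)"
    by (rule continuous_on_compose2[OF cont[OF x y]]) (auto intro!: continuous_intros)
  then have 1: "continuous_on {..t} (\<lambda>s. cinner H (kern i s t x) y)"
    by (simp add: kern_le cong: continuous_on_cong_simp)
  have "continuous_on {t..} (\<lambda>s. cnj (cinner H (T i (s - t) y) x))"
    by (intro continuous_on_cnj continuous_on_compose2[OF cont[OF y x]]) (auto intro!: continuous_intros)
  moreover have "cnj (cinner H (T i (s - t) y) x) = cinner H (kern i s t x) y" if "s \<ge> t" for s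
    using that x y cinner_commute[of x "T i (s - t) y"] by (simp add: kern_adjoint kern_le)
  ultimately have 2: "continuous_on {t..} (\<lambda>s. cinner H (kern i s t x) y)"
    by (simp cong: continuous_on_cong_simp)
  have "continuous_on ({..t} \<union> {t..}) (\<lambda>s. cinner H (kern i s t x) y)"
    using 1 2 by (intro continuous_on_closed_Un) auto
  moreover have "{..t} \<union> {t..} = UNIV" by auto
  ultimately show ?thesis by simp
qed

lemma comb_weakly_continuous:
  assumes "valid l" "y \<in> carrier H"
  shows "continuous_on UNIV (\<lambda>s. cinner H (comb l i s) y)"
  using assms
proof (induction l)
  case (Cons a l)
  obtain j t x where a: "a = (j, t, x)" by (cases a)
  have "continuous_on UNIV (\<lambda>s. cinner H (glued i s j t x) y)"
    using Cons.prems by (cases "i = j") (auto simp: a glued_eq intro!: kern_weakly_continuous)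
  then show ?case
    using Cons by (simp add: a cinner_simps continuous_on_add)
qed (simp add: cinner_simps)

lemma form_shift_continuous:
  assumes "valid l" "valid m"
  shows "continuous_on UNIV (\<lambda>h. form (shift_list i h l) m)"
  using assms(2)
proof (induction m)
  case (Cons b m)
  obtain j s y where b: "b = (j, s, y)" by (cases b)
  have y: "y \<in> carrier H" and m: "valid m" using Cons.prems by (auto simp: b)
  have cont: "continuous_on UNIV (\<lambda>h. cinner H (comb l i (g h)) z)"
    if "continuous_on UNIV g" "z \<in> carrier H" for g z
    by (rule continuous_on_compose2[OF comb_weakly_continuous[OF assms(1) that(2)] that(1)]) simp
  have "continuous_on UNIV (\<lambda>h. form (shift_list i h l) [b])"
    using assms(1) y
    by (cases "j = i") (auto simp: b form_single_right comb_shift_list cinner_shift intro!: continuous_intros cont)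
  then show ?case
    using Cons.IH[OF m] by (subst form_Cons_right) (intro continuous_on_add)
qed simp

text \<open>
  For a unitary \<open>U\<close>, \<open>\<parallel>U g - g\<parallel>\<^sup>2 = 2 \<parallel>g\<parallel>\<^sup>2 - 2 Re \<langle>U g, g\<rangle>\<close>, so weak continuity at a combination \<open>g\<close> is
  strong continuity there; combinations are dense and the shifts are isometric.
\<close>

lemma shift_continuous_at_0:
  assumes f: "f \<in> carrier rkhs"
  shows "((\<lambda>h. cnorm rkhs (shift i h f \<ominus>\<^bsub>rkhs\<^esub> f)) \<longlongrightarrow> 0) (at 0)"
proof (rule tendstoI)
  fix e :: real assume "e > 0"
  then obtain l where l: "valid l" "cnorm rkhs (f \<ominus>\<^bsub>rkhs\<^esub> comb l) < e / 3"
    using comb_dense[OF f, of "e / 3"] by auto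
  define g where "g = comb l"
  have g: "g \<in> carrier rkhs" using l by (simp add: g_def)
  have inner_g: "inner (shift i h g) g = form (shift_list i h l) l" for h
    using l(1) by (simp add: g_def inner_comb flip: comb_shift_list)
  have "((\<lambda>h. inner (shift i h g) g) \<longlongrightarrow> inner (shift i 0 g) g) (at 0)"
    using form_shift_continuous[OF l(1) l(1), of i]
    by (simp add: inner_g continuous_on_eq_continuous_within continuous_within)
  then have "((\<lambda>h. 2 * (cnorm rkhs g)\<^sup>2 - 2 * Re (inner (shift i h g) g)) \<longlongrightarrow>
      2 * (cnorm rkhs g)\<^sup>2 - 2 * Re (inner (shift i 0 g) g)) (at 0)"
    by (intro tendsto_intros)
  moreover have "2 * (cnorm rkhs g)\<^sup>2 - 2 * Re (inner (shift i h g) g)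
      = (cnorm rkhs (shift i h g \<ominus>\<^bsub>rkhs\<^esub> g))\<^sup>2" for h
    using g by (simp add: rkhs.cnorm_diff_power2 cnorm_shift)
  moreover have "2 * (cnorm rkhs g)\<^sup>2 - 2 * Re (inner (shift i 0 g) g) = 0"
    using g rkhs.cnorm_power2[OF g] by (simp add: shift_0)
  ultimately have "((\<lambda>h. (cnorm rkhs (shift i h g \<ominus>\<^bsub>rkhs\<^esub> g))\<^sup>2) \<longlongrightarrow> 0) (at 0)"
    by simp
  then have "((\<lambda>h. cnorm rkhs (shift i h g \<ominus>\<^bsub>rkhs\<^esub> g)) \<longlongrightarrow> 0) (at 0)"
    by simp
  then have "\<forall>\<^sub>F h in at 0. cnorm rkhs (shift i h g \<ominus>\<^bsub>rkhs\<^esub> g) < e / 3"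
    using \<open>e > 0\<close> by (intro order_tendstoD(2)) auto
  then show "\<forall>\<^sub>F h in at 0. dist (cnorm rkhs (shift i h f \<ominus>\<^bsub>rkhs\<^esub> f)) 0 < e"
  proof eventually_elim
    case (elim h)
    have "cnorm rkhs (shift i h f \<ominus>\<^bsub>rkhs\<^esub> shift i h g) = cnorm rkhs (f \<ominus>\<^bsub>rkhs\<^esub> g)"
      using f g by (simp add: cnorm_shift flip: shift_linear(2))
    moreover have "cnorm rkhs (g \<ominus>\<^bsub>rkhs\<^esub> f) = cnorm rkhs (f \<ominus>\<^bsub>rkhs\<^esub> g)"
      by (rule rkhs.cnorm_minus_commute[OF g f])
    moreover have "cnorm rkhs (shift i h f \<ominus>\<^bsub>rkhs\<^esub> f) \<le>
        cnorm rkhs (shift i h f \<ominus>\<^bsub>rkhs\<^esub> shift i h g) + cnorm rkhs (shift i h g \<ominus>\<^bsub>rkhs\<^esub> f)"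
      using f g by (intro rkhs.cnorm_diff_triangle) auto
    moreover have "cnorm rkhs (shift i h g \<ominus>\<^bsub>rkhs\<^esub> f) \<le>
        cnorm rkhs (shift i h g \<ominus>\<^bsub>rkhs\<^esub> g) + cnorm rkhs (g \<ominus>\<^bsub>rkhs\<^esub> f)"
      using f g by (intro rkhs.cnorm_diff_triangle) auto
    ultimately have "cnorm rkhs (shift i h f \<ominus>\<^bsub>rkhs\<^esub> f) < e"
      using elim l(2) by (simp flip: g_def)
    then show ?case
      using f by (simp add: rkhs.cnorm_nonneg)
  qed
qed

lemma unitary_representation_shift: "unitary_representation rkhs (shift i)"
  unfolding unitary_representation_def
proof (intro conjI allI ballI)
  show "strongly_continuous_on UNIV rkhs (shift i)"
  proof (rule rkhs.strongly_continuous_onI)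
    fix f and a :: real assume f: "f \<in> carrier rkhs"
    have "((\<lambda>h. cnorm rkhs (shift i (a + h) f \<ominus>\<^bsub>rkhs\<^esub> shift i a f)) \<longlongrightarrow> 0) (at 0)"
      using shift_continuous_at_0[OF f, of i] f
      by (simp add: cnorm_shift flip: shift_shift shift_linear(2))
    then show "((\<lambda>t. cnorm rkhs (shift i t f \<ominus>\<^bsub>rkhs\<^esub> shift i a f)) \<longlongrightarrow> 0) (at a)"
      by (rule LIM_offset_zero_cancel)
  qed auto
qed (simp_all add: unitary_shift shift_0 shift_shift)


section \<open>The dilation\<close>

definition embed :: "'a \<Rightarrow> 'i \<Rightarrow> real \<Rightarrow> 'a"
  where "embed x = (\<lambda>i s. kern i s 0 x)"

lemma embed_past: "0 \<le> s \<Longrightarrow> embed x i (- s) = T i s x"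
  by (simp add: embed_def kern_le)

lemma embed_origin [simp]: "x \<in> carrier H \<Longrightarrow> embed x i 0 = x"
  by (simp add: embed_def)

lemma embed_eq_comb:
  assumes "x \<in> carrier H"
  shows "embed x = comb [(i, 0, x)]"
  using assms by (auto intro!: ext simp: embed_def glued_eq)

lemma embed_in_rkhs [simp, intro]: "x \<in> carrier H \<Longrightarrow> embed x \<in> carrier rkhs"
  by (simp add: embed_eq_comb[of x undefined] del: comb_simps)

lemma inner_embed:
  assumes "f \<in> carrier rkhs" "y \<in> carrier H"
  shows "inner f (embed y) = cinner H (f i 0) y"
  using assms by (simp add: embed_eq_comb[of y i] reproducing del: comb_simps)

lemma isometry_embed: "isometry H rkhs embed"
  unfolding isometry_def linear_operator_def
proof (intro conjI allI ballI)
  fix x assume x: "x \<in> carrier H"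
  show "cnorm rkhs (embed x) = cnorm H x"
    using x inner_embed[of "embed x" x undefined] by (simp add: cnorm_def)
  show "embed (c \<odot> x) = c \<odot>\<^bsub>rkhs\<^esub> embed x" for c
    using x by (simp add: embed_def kern_linear)
  show "embed (x \<oplus> y) = embed x \<oplus>\<^bsub>rkhs\<^esub> embed y" if "y \<in> carrier H" for y
    using x that by (simp add: embed_def kern_linear)
qed auto

text \<open>
  Evaluation at time 0 is the same for every index, since time 0 of each index represents \<open>H\<close>.
\<close>

lemma adjoint_embed:
  assumes f: "f \<in> carrier rkhs"
  shows "adjoint_op H rkhs embed f = f i 0"
proof (rule adjoint_eqI)
  fix z assume z: "z \<in> carrier H"
  then show "cinner rkhs (embed z) f = cinner H z (f i 0)"
    using f inner_commute[of "embed z" f] inner_embed[of f z i] cinner_commute[of z "f i 0"] by simp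
qed (use f in simp)

text \<open>
  The functions for the vectors \<open>x + v\<close> where \<open>v\<close> is a sum of components in the outgoing parts of the
  dilations. As \<open>f i (- s)\<close> is the projection of \<open>U\<^sub>i(s) (x + v)\<close> to \<open>H\<close>, the condition says
  that all future projections to \<open>H\<close> are determined by the present one.
\<close>

definition outgoing :: "'a \<Rightarrow> ('i \<Rightarrow> real \<Rightarrow> 'a) set"
  where "outgoing x = {f \<in> carrier rkhs. x \<in> carrier H \<and> (\<forall>i. \<forall>s\<ge>0. f i (- s) = T i s x)}"

lemma outgoing_origin: "f \<in> outgoing x \<Longrightarrow> f i 0 = x"
  by (auto simp: outgoing_def dest!: spec[where x = i] spec[where x = "0 :: real"])


lemma embed_outgoing: "x \<in> carrier H \<Longrightarrow> embed x \<in> outgoing x"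
  by (simp add: outgoing_def embed_past)

text \<open>
  For the index \<open>i\<close> this is the semigroup law; for \<open>j \<noteq> i\<close> the correction term in \<open>shift\<close> exchanges
  \<open>T j s x\<close> for \<open>T j s (T i h x)\<close>.
\<close>

lemma shift_outgoing:
  assumes f: "f \<in> outgoing x" and h: "0 \<le> h"
  shows "shift i h f \<in> outgoing (T i h x)"
proof -
  have past: "f j (- s) = T j s x" if "0 \<le> s" for j s
    using f that by (simp add: outgoing_def)
  have x: "x \<in> carrier H"
    using f by (simp add: outgoing_def)
  note origin = outgoing_origin[OF f]
  have "shift i h f j (- s) = T j s (T i h x)" if s: "0 \<le> s" for j s
  proof (cases "j = i")
    case True
    then show ?thesis
      using past[of "s + h" i] s h x T_add[of s h x i] by (simp add: shift_def)
  next
    case False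
    have "T j s x \<oplus> (T j s (T i h x) \<ominus> T j s x) = T j s (T i h x)"
      using s h x by (intro vector_eqI) (auto simp: cinner_simps)
    then show ?thesis
      using False past[OF s] past[OF h] origin s h x
      by (simp add: shift_def kern_linear) (simp add: kern_le)
  qed
  then show ?thesis
    using f x h by (simp add: outgoing_def)
qed

lemma ordered_prod_outgoing:
  assumes x: "x \<in> carrier H" and t: "\<forall>k\<in>{1..N}. 0 \<le> t k"
  shows "ordered_prod (\<lambda>k. shift (i k) (t k)) N (embed x)
    \<in> outgoing (ordered_prod (\<lambda>k. T (i k) (t k)) N x)"
proof -
  have "foldr (\<lambda>k B. shift (i k) (t k) \<circ> B) ks id (embed x)
      \<in> outgoing (foldr (\<lambda>k B. T (i k) (t k) \<circ> B) ks id x)"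
    if "\<forall>k\<in>set ks. 0 \<le> t k" for ks
    using that by (induction ks) (simp_all add: x embed_outgoing shift_outgoing)
  then show ?thesis
    using t by (simp add: ordered_prod_def del: upt_Suc)
qed

theorem dilation:
  assumes "x \<in> carrier H" "\<forall>k\<in>{1..N}. 0 \<le> t k"
  shows "ordered_prod (\<lambda>k. T (i k) (t k)) N x =
    adjoint_op H rkhs embed (ordered_prod (\<lambda>k. shift (i k) (t k)) N (embed x))"
proof -
  let ?v = "ordered_prod (\<lambda>k. T (i k) (t k)) N x"
  let ?f = "ordered_prod (\<lambda>k. shift (i k) (t k)) N (embed x)"
  have f: "?f \<in> outgoing ?v"
    by (rule ordered_prod_outgoing[OF assms])
  then show ?thesis
    using adjoint_embed[of ?f undefined] outgoing_origin[OF f] by (simp add: outgoing_def)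
qed

end

lemma identity_semigroup:
  assumes "complex_inner_space H"
  shows "contractive_C0_semigroup H (\<lambda>t x. x)"
proof -
  interpret complex_inner_space H by (rule assms)
  show ?thesis
    by (auto simp: contractive_C0_semigroup_def contraction_def linear_operator_def
        strongly_continuous_on_def)
qed

theorem theorem1p4:
  fixes H :: "'a cinner_space"
    and I :: "'i set"
    and T :: "'i \<Rightarrow> real \<Rightarrow> 'a \<Rightarrow> 'a"
  assumes "complex_hilbert_space H"
    and "I \<noteq> {}"
    and "\<And>i. i \<in> I \<Longrightarrow> contractive_C0_semigroup H (T i)"
  shows "\<exists>(H' :: ('i \<Rightarrow> real \<Rightarrow> 'a) cinner_space)
            (U :: 'i \<Rightarrow> real \<Rightarrow> ('i \<Rightarrow> real \<Rightarrow> 'a) \<Rightarrow> ('i \<Rightarrow> real \<Rightarrow> 'a))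
            (r :: 'a \<Rightarrow> ('i \<Rightarrow> real \<Rightarrow> 'a)).
      complex_hilbert_space H' \<and>
      (\<forall>i\<in>I. unitary_representation H' (U i)) \<and>
      isometry H H' r \<and>
      (\<forall>(N :: nat) (i :: nat \<Rightarrow> 'i) (t :: nat \<Rightarrow> real).
         1 \<le> N \<and> (\<forall>k\<in>{1..N}. i k \<in> I \<and> 0 \<le> t k) \<longrightarrow>
         (\<forall>x\<in>carrier H.
            ordered_prod (\<lambda>k. T (i k) (t k)) N x =
            adjoint_op H H' r (ordered_prod (\<lambda>k. U (i k) (t k)) N (r x))))"
proof -
  \<comment> \<open>the functions of \<open>H'\<close> have arguments outside \<open>I\<close> as well; there the identity semigroup serves\<close>
  define T' where "T' i = (if i \<in> I then T i else (\<lambda>t x. x))" for i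
  interpret D: contractive_family H T'
    using assms identity_semigroup
    by (intro contractive_family.intro contractive_family_axioms.intro)
      (auto simp: T'_def complex_hilbert_space_def)
  show ?thesis
  proof (intro exI conjI ballI allI impI)
    show "complex_hilbert_space D.rkhs"
      by (rule D.rkhs_complete)
    show "unitary_representation D.rkhs (D.shift i)" for i
      by (rule D.unitary_representation_shift)
    show "isometry H D.rkhs D.embed"
      by (rule D.isometry_embed)
    fix N :: nat and i :: "nat \<Rightarrow> 'i" and t :: "nat \<Rightarrow> real" and x
    assume t: "1 \<le> N \<and> (\<forall>k\<in>{1..N}. i k \<in> I \<and> 0 \<le> t k)" and x: "x \<in> carrier H"
    have "ordered_prod (\<lambda>k. T (i k) (t k)) N = ordered_prod (\<lambda>k. T' (i k) (t k)) N"
      unfolding ordered_prod_def using t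
      by (intro foldr_cong refl) (auto simp: T'_def)
    then show "ordered_prod (\<lambda>k. T (i k) (t k)) N x =
        adjoint_op H D.rkhs D.embed (ordered_prod (\<lambda>k. D.shift (i k) (t k)) N (D.embed x))"
      using D.dilation[OF x, of N t i] t by simp
  qed
qed

end
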